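(* Consider a discrete workspace, a team of $n$ robots of $m$ types and a valid specification $\phi\in\mathrm{LTL}^\chi$. Then any path $\tilde\tau=\tilde\tau^{\mathrm{pre}}[\tilde\tau^{\mathrm{suf}}]^\omega$ returned by the synthesis method described in the context (obtained by concatenating the solutions of its generalized multi-robot path planning problems, GMRPP) satisfies the specification $\phi$. Moreover this holds irrespective of the specific implementation of the GMRPP (with or without collision avoidance, sequential or simultaneous execution, full or partial execution, as described in the context).
   Context: **Workspace and robots.** $E=(S,\to_E)$ is a finite graph of free cells with adjacency relation $\to_E$; $\ell_1,\dots,\ell_l\subseteq S$ are labeled regions. There are $n$ robots of $m$ types; $\mathcal K_j$ is the set of robots of type $j$ (pairwise disjoint), $\mathcal R=\bigcup_j\mathcal K_j$. At each discrete time step every robot stays in its cell or moves to an adjacent cell. A configuration is an element of $S^n$; the initial configuration $s^0$ is given. A robot path is a sequence of configurations starting at $s^0$ with legal moves. A cost $d\ge 0$ is given on pairs of cells. **Propositions and tasks.** $\pi_{i,j}^{k}$ is true at a configuration iff at least $i$ robots of type $j$ are in $\ell_k$. $\mathcal{AP}=\{\pi_{i,j}^{k,\chi}:\chi\in\mathbb N\}$; $\pi_{i,j}^{k,0}$ is $\pi_{i,j}^k$; for $\chi\ne0$, positive occurrences with the same $i,j,\chi$ must be made true by the same $i$ robots of type $j$; $\neg\pi_{i,j}^{k,\chi}$ means $\neg\pi_{i,j}^{k}$. $\mathrm{LTL}^\chi$: LTL formulas over $\mathcal{AP}$. A formula is valid if propositions with the same nonzero $\chi$ have the same $i$ and $j$.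 A path $\tau=\tau^{\mathrm{pre}}[\tau^{\mathrm{suf}}]^\omega$ (with $\tau^{\mathrm{pre}}$ executed once, then the loop $\tau^{\mathrm{suf}}$, which starts and ends at the last configuration of $\tau^{\mathrm{pre}}$, repeated forever) satisfies $\phi$ if its trace satisfies $\phi$ with all connectors replaced by $0$, and the same $i$ robots of type $j$ satisfy the propositions with the same nonzero connector. **NBA.** $\mathcal A_\phi=(\mathcal V,\mathcal E)$ is a nondeterministic Büchi automaton for $\phi$ viewed as a graph; transitions are labeled by propositional formulas in DNF. The label of the self-loop at $v$ is the vertex label $\gamma(v)$ ($\bot$ if there is no self-loop); for $v_1\neq v_2$, $\gamma(v_1,v_2)$ is the edge label. A clause is a conjunction of literals; its positive (negative) subformula is the conjunction of its positive (negative) literals ($\top$ if none). Pre-processing is applied to every clause: (1) a positive literal $\pi_{i,j}^k$ is deleted if another positive literal $\pi_{i',j}^{k,\chi'}$ with $i\le i'$ is present, and replaced by $\pi_{i-i',j}^k$ if $i>i'$; (2) $\neg\pi_{i,j}^k$ is deleted if $\neg\pi_{i',j}^k$ with $i'<i$ is present; (3) the clause is replaced by $\bot$ if it contains $\pi_{i,j}^{k,\chi},\pi_{i,j}^{k',\chi}$ with $k\ne k'$, $\chi\neq0$; (4) or if it contains $\pi_{i,j}^{k,\chi}$ and $\neg\pi_{i',j}^k$ with $i'\le i$; (5) or if for some $j$ the sum of $i$ over its positive literals of type $j$ exceeds $|\mathcal K_j|$. $\mathcal A_\phi$ denotes the result. **Implication.** $\gamma\Rightarrow\gamma'$ if for each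 clause of $\gamma$ there is a clause of $\gamma'$ all of whose literals occur in it ($\top$ is a subformula of any clause). $\gamma\Rightarrow_s\gamma'$ if moreover each clause of $\gamma'$ is a subformula of some clause of $\gamma$. **The method.** *Step 1 (prune, relax).* $\mathcal A_\phi^-$ is obtained from $\mathcal A_\phi$ by deleting edges labeled $\bot$; deleting vertices without self-loop other than initial and accepting ones; for every non-accepting vertex deleting incoming edges whose label does not strongly imply its vertex label; deleting non-initial vertices not reachable from other vertices. $\mathcal A_{\mathrm{relax}}$ is obtained by replacing all negative literals by $\top$. For a label $\gamma$ (or clause) in a derived automaton, $\gamma_\phi$ denotes the corresponding one in $\mathcal A_\phi$. A vertex that is both initial and accepting is treated as two vertices. *Step 2 (sub-NBA, prefix).* All pairs $(v_0,v_{\mathrm{accept}})$ of initial and accepting vertices connected in $\mathcal A_{\mathrm{relax}}$ by a simple path and with a simple cycle (or self-loop) at $v_{\mathrm{accept}}$ are iterated over, in order of total length. For a pair: remove other initial and accepting vertices; if $v_0$ has a self-loop and $s^0$ does not satisfy $\gamma_\phi(v_0)$, remove the self-loop; if $v_0$ has no self-loop (any more), remove outgoing edges of $v_0$ with $\gamma_\phi$ not satisfied by $s^0$; remove outgoing edges of $v_{\mathrm{accept}}$ (if $\ne v_0$); keep the vertices lying on some path from $v_0$ to $v_{\mathrm{accept}}$ and all edges among them, giving $\mathcal A_{\mathrm{subtask}}$. Remove every composite edge $(v_1,v_3)$, i.e. one for which there is $v_2$ with $\gamma(v_1,v_3)=\gamma(v_1,v_2)\wedge\gamma(v_2,v_3)$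 and ($\gamma_\phi(v_3)=\top$ if $v_3=v_{\mathrm{accept}}$); this gives $\mathcal A^-_{\mathrm{subtask}}$. *Step 3 (posets).* A subtask is an edge $(v_1,v_2)$ with its edge label and starting vertex label; two edges not lying on a common path from $v_0$ to $v_{\mathrm{accept}}$ and having equal edge labels and equal starting vertex labels are identified. The simple paths from $v_0$ to $v_{\mathrm{accept}}$ are partitioned into classes with the same set of subtasks; each class is a set $\Xi$ of linear orders. A poset $P=(X_P,<_P)$ whose linear extensions all lie in $\Xi$, with the maximum number of them, is computed; each linear order of $\Xi$ not covered is a further poset. All posets are iterated over. For $e\in X_P$, $X^e_<,X^e_\prec,X^e_\succ,X^e_\|$ are the sets of elements smaller than (to be completed before), covered by, covering, and incomparable to $e$. $F=\{e: X^e_\prec=\emptyset\}$ are the candidates for first, $\Lambda=\{e:X^e_\succ=\emptyset\}$ the candidates for last completed subtask. *Step 4 (routing graph $\mathcal G$).* Vertices: one initial vertex $v$ per robot $r_v$ (set $V_{\mathrm{init}}$); for each $e=(v_1,v_2)\in X_P$, for the edge label (type $a=1$) if $\neq\top$ and the starting vertex label $\gamma(v_1)$ (type $a=0$) if $\ne\top,\bot$, for each clause $p$ and each of its literals $q$, $\pi_{i,j}^{k,\chi}$, a set $V(e,a,p,q)$ of $i$ vertices located at $\ell_k$ with robot set $K(v)=\mathcal K_j$. $V(e,a,p)=\bigcup_qV(e,a,p,q)$. Edges into the vertices of a literal $\pi_{i,j}^{k,\chi}$ of the edge label of $e$: (i) from all initial vertices of robots of type $j$; (ii) from the vertices of every literal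 with type $j$ and number $i'$ in the edge label and starting vertex label of each $e'\in X^e_<\cup X^e_\|$ ($i$ one-to-one edges if $i'=i$, all $ii'$ edges otherwise); (iii) likewise from literals of type $j$ in $\gamma(v_1)$ of $e$. Edges into the vertices of a literal $\pi_{i,j}^{k,\chi}$ of clause $C$ of the starting vertex label of $e$: for each $e'\in X^e_\prec\cup X^e_\|$ and each clause $C'$ in its edge label such that $C_\phi$ is a subformula of $C'_\phi$, $i$ one-to-one edges from the vertices of the counterpart literal in $C'$; and, if $X^e_\prec=\emptyset$, edges from all initial vertices of robots of type $j$. $T^*_{uv}$ and $d_{uv}$ are the shortest travel time and cost between the locations of $u,v$. *Step 5 (prefix MILP).* Variables: $x_{uvr}\in\{0,1\}$, $t^\pm_{vr}\in\mathbb N$, binary $b_p$ for each clause, $t_e$ (completion time), binary $b_{ee'},b_e^{e'},b_e^\prec$; $M$ is a large constant. Write $X_v^r=\sum_{u:(u,v)}x_{uvr}$, $X_v=\sum_{r\in K(v)}X_v^r$, $T_v^\pm=\sum_{r\in K(v)}t_{vr}^\pm$. Constraints: - for $v\notin V_{\mathrm{init}}$: $X_v\le1$, $\sum_wx_{vwr}\le X_v^r$, $0\le t^\pm_{vr}\le MX_v^r$; for $v\in V_{\mathrm{init}}$: $\sum_wx_{vwr_v}\le1$, $\sum_w x_{vwr}=0$ for $r\neq r_v$, $t^\pm_{vr}=0$; $t_{vr}^-=t_{vr}^+$ for vertices of edge labels and $t_{vr}^-\le t_{vr}^+$ for those of vertex labels; - $t_{ur}^++(T^*_{uv}+\delta)x_{uvr}\le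 t_{vr}^-+M(1-x_{uvr})$ with $\delta=1$ if the subtasks of $u,v$ are incomparable, else $\delta=0$; - for every label $\ne\top,\bot$: $\sum_pb_p=1$, and $\sum_{v\in V(e,a,p)}X_v=b_p\sum_q i^q$ (where $i^q$ is the number in literal $q$); for edge labels $T_u^-=T_v^-$ for $u,v\in V(e,1,p)$; - $t_e=\sum_pT^-_{v_p}$ with $v_p\in V(e,1,p)$ arbitrary; if $\gamma(v_1)\ne\top,\bot$: $T_v^-\le t_e\le T_v^++1+M(1-b_p)$ for $v\in V(e,0,p)$; $t_e=0$ if $\gamma(v_1)=\bot$; - $t_{e'}+1\le t_e$ for $e'\in X^e_\prec$; - $b_e^{e'}+b_{e'}^e=1$ and $M(b_e^{e'}-1)\le t_e-t_{e'}\le Mb_e^{e'}-1$ for $e\ne e'$; - if $X^e_\succ\neq\emptyset$: $\sum_{e'\in X^e_\succ\cup X^e_\|}b_{ee'}=1$; if $X^e_\succ=\emptyset$, with $z=|X^e_\||$ and sums over $e'\in X^e_\|$: $\sum b_{ee'}\le1$, $z-\sum b_e^{e'}\le M\sum b_{ee'}$, $\sum b_{ee'}\le M(z-\sum b_e^{e'})$; in both cases $t_e+1\le t_{e'}+M(1-b_{ee'})$ and $T_v^-\le t_e+1+M(1-b_{ee'})$ for all $v\in V(e',0,p)$, all $p$; - if $X^e_\prec\ne\emptyset$: $\sum_{e'\in X^e_\prec\cup X^e_\|}b_{e'e}=1$; otherwise, with sums over $X^e_\|$: $\sum b_{e'e}\le1$, $\sum b_e^{e'}\le M\sum b_{e'e}$,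 $\sum b_{e'e}\le M\sum b_e^{e'}$; - for $e\in F$, with $\beta_e=\sum_{e'\in F\setminus\{e\}}b_e^{e'}$: $T_v^-\le M(\beta_e+1-b_p)$ for $v\in V(e,0,p)$; $\beta_e\le M(1-b_e^\prec)$, $1-b_e^\prec\le M\beta_e$; for each clause $p$ of the starting vertex label, $\sum_{v\in V(e,0,p)}\sum_{u\notin V_{\mathrm{init}}}\sum_rx_{uvr}\le M(1-b_e^\prec)$ and $\sum_{v\in V(e,0,p)}\sum_{u\in V_{\mathrm{init}}}\sum_rx_{uvr}\le Mb_e^\prec$; - for clauses $p,p'$ containing $\pi_{i,j}^{k,\chi},\pi_{i,j}^{k',\chi}$ with the same $\chi\ne0$ and $b$-th vertices $v_k^b,v_{k'}^b$: $X^r_{v_k^b}=X^r_{v_{k'}^b}$ whenever $b_p=b_{p'}=1$ (big-$M$ form); - a chosen last subtask $e\in\Lambda$ and clause $p$ of its edge label: $b_e^{e'}=1$ for all $e'\ne e$ and $b_p=1$; all choices $(e,p)$ are iterated over until a path is found. Objective: minimize $\alpha\sum d_{uv}x_{uvr}+(1-\alpha)\sum_et_e$. *Step 6 (low-level prefix path).* Sorting the $t_e$ yields a simple path in $\mathcal A_{\mathrm{subtask}}^-$ and its counterpart in $\mathcal A_\phi$. For each subtask $(v_1,v_2)$ of it: $\gamma_1^+,\gamma_{1,2}^+$ are the clauses with $b_p=1$ in the starting vertex label and edge label ($\top$ if the label is $\top$), with essential robots $\mathcal R_1,\mathcal R_{1,2}$ those assigned to their literals by the MILP; $\gamma_1^-,\gamma_{1,2}^-$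 are the negative subformulas of the corresponding clauses in $\mathcal A_\phi$ (if the relaxed label is $\top$, a clause with only negative literals, if any, is chosen: for an edge label arbitrarily; for a vertex label one implied by the clause chosen for the preceding edge, or, for the first subtask, one satisfied by $s^0$). If the first completion time is $0$, the first subtask is already completed by $s^0$. Otherwise a generalized multi-robot path planning problem (GMRPP) is solved, in the order of the subtasks: find a horizon $T$ (increased until feasible) and a minimum-cost path segment for all robots, from the current locations at time $0$, such that robots in $\mathcal R_{1,2}$ are in their target regions (of $\gamma_{1,2}^+$) at time $T$, robots in $\mathcal R_1$ are in their target regions (of $\gamma_1^+$) at times $1,\dots,T-1$, $\gamma_1^-$ holds at times $1,\dots,T-1$, and $\gamma_{1,2}^-$ holds at time $T$. The segments are concatenated to give $\tilde\tau^{\mathrm{pre}}$. *Step 7 (suffix).* Let $s_{\mathrm{prior}}$ be the final configuration of the prefix path, $(v_{\mathrm{prior}},v_{\mathrm{accept}})$ the last edge and $C_{\mathrm{prior}}$ the satisfied clause of $\gamma_\phi(v_{\mathrm{prior}},v_{\mathrm{accept}})$, with positive subformula $C^+_{\mathrm{prior}}$. If $v_{\mathrm{accept}}$ has a self-loop and $s_{\mathrm{prior}}$ satisfies $\gamma_\phi(v_{\mathrm{accept}})$, the robots stay at $s_{\mathrm{prior}}$ forever. Otherwise remove this self-loop; from $\mathcal A_{\mathrm{relax}}$ remove all other accepting vertices, all initial vertices without self-loops, all outgoing and all incoming edges of $v_{\mathrm{accept}}$ whose label in $\mathcal A_\phi$ is not implied by $\gamma_\phi(v_{\mathrm{prior}},v_{\mathrm{accept}})$;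 proceed as in Steps 2–5 with $v_{\mathrm{accept}}$ playing both the role of $v_0$ and of the goal and $s_{\mathrm{prior}}$ that of the initial configuration, with these changes: the edge label of each $e\in\Lambda$ gets the extra clause $C^+_{\mathrm{prior}}$ (index $p_e$), each of whose vertices $v$ is assigned to one specific robot $r_v$, namely a robot that satisfied that literal at $s_{\mathrm{prior}}$, has no outgoing edges, and receives edges from all admissible leaving vertices; the choice of last subtask and clause is replaced by binaries $b_e$ ($e\in\Lambda$) with $\sum_{e\in\Lambda}b_e=1$, $1+M(\sum_{e'\in\Lambda\setminus e}b_e^{e'}-z)\le b_e\le1+M(z-\sum_{e'\in\Lambda\setminus e}b_e^{e'})$, $z=|\Lambda|-1$, and $\sum_{v\in V(e,1,p_e,q)}X_v^{r_v}=i^qb_e$; literals with a nonzero connector already used in the prefix must be satisfied by the same robots as there. Low-level paths are computed as in Step 6 (the last subtask satisfying $C_{\mathrm{prior}}$), and finally a last GMRPP brings all robots back to $s_{\mathrm{prior}}$ while keeping $C_{\mathrm{prior}}$ true. The concatenation is $\tilde\tau^{\mathrm{suf}}$. The method iterates over pairs, prefix posets, choices of last subtask and clause, and suffix posets; it may return any path obtained. **Implementations of the GMRPP.** *Full, sequential*: as in Step 6. *Collision avoidance*: additionally no two robots occupy the same cell at the same time or swap adjacent cells in one step (and clauses requiring more robots in a region than it has cells are deleted in pre-processing). *Simultaneous execution*: robots outside $\mathcal R_1\cup\mathcal R_{1,2}$ that are needed for later subtasks may additionally be required to be at time $T$ at an intermediate target cell on a shortest route to their next waypoint, this cell not being in a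 region $\ell_k$ for which a literal $\neg\pi_{i,j}^k$ with their type $j$ occurs in $\gamma_1^-$ or $\gamma_{1,2}^-$. *Partial execution*: only robots with targets and a set $\mathcal R^-$ of robots move, all others stay put and are treated as obstacles. Here, for each literal $\neg\pi_{i,j}^k$ of $\gamma_1^-$ or $\gamma_{1,2}^-$, let $i'$ be the number of robots of type $j$ in $\ell_k$ at time $0$ of the GMRPP; if $i'<i$, the robots of type $j$ are not put in $\mathcal R^-$ and the literal is replaced by $\neg\pi_{i-i',j}^k$; if $i'\ge i$, $i'-i+1$ of the type-$j$ robots in $\ell_k$ are put in $\mathcal R^-$ and the literal is replaced by $\neg\pi_{1,j}^k$ (these updated literals being imposed on the moving robots).
   Formalization: A first completion time 0 counts only if s^0 satisfies a full edge clause, negative literals included; label tests at s^0 and s_prior use disjoint robots for literals of equal type and region and the connector teams of the run; absorption rule (1) is applied in a fixed order. *)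

theory Defs
  imports
    Complex_Main
    "HOL-Library.FuncSet"
    "HOL-Library.Extended_Nat"
    "HOL-Library.Omega_Words_Fun"
begin

section \<open>Workspace, robots, propositions and tasks\<close>

text \<open>Robots, types and regions are numbered from 0. A configuration is an element of
  \<open>S^n\<close>, encoded as an extensional function on the robots.\<close>

type_synonym 'c config = "nat \<Rightarrow> 'c"

record 'c wspace =
  cells :: "'c set"
  adj :: "('c \<times> 'c) set"
  nreg :: nat
  region :: "nat \<Rightarrow> 'c set"
  nrob :: nat
  ntyp :: nat
  team :: "nat \<Rightarrow> nat set"
  init_conf :: "'c config"
  cost :: "'c \<Rightarrow> 'c \<Rightarrow> real"

abbreviation robots :: "'c wspace \<Rightarrow> nat set" where
  "robots W \<equiv> {..<nrob W}"

definition configs :: "'c wspace \<Rightarrow> 'c config set" where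
  "configs W = robots W \<rightarrow>\<^sub>E cells W"

definition workspace :: "'c wspace \<Rightarrow> bool" where
  "workspace W \<longleftrightarrow>
     finite (cells W) \<and> adj W \<subseteq> cells W \<times> cells W \<and>
     (\<forall>k<nreg W. region W k \<subseteq> cells W) \<and>
     (\<Union>j<ntyp W. team W j) = robots W \<and>
     (\<forall>j<ntyp W. \<forall>j'<ntyp W. j \<noteq> j' \<longrightarrow> team W j \<inter> team W j' = {}) \<and>
     init_conf W \<in> configs W \<and>
     (\<forall>c\<in>cells W. \<forall>c'\<in>cells W. 0 \<le> cost W c c')"

definition legal_step :: "'c wspace \<Rightarrow> 'c config \<Rightarrow> 'c config \<Rightarrow> bool" where
  "legal_step W s s' \<longleftrightarrow> (\<forall>r\<in>robots W. s' r = s r \<or> (s r, s' r) \<in> adj W)"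

text \<open>The atom \<open>Prp i j k \<chi>\<close> is the proposition \<open>\<pi>\<close> with number \<open>i\<close>, type \<open>j\<close>, region \<open>k\<close>
  and connector \<open>\<chi>\<close>.\<close>

datatype prp = Prp (num: nat) (kind: nat) (reg: nat) (conn: nat)

definition unconn :: "prp \<Rightarrow> prp" where
  "unconn a = Prp (num a) (kind a) (reg a) 0"

definition present :: "'c wspace \<Rightarrow> 'c config \<Rightarrow> prp \<Rightarrow> nat" where
  "present W s a = card {r \<in> team W (kind a). s r \<in> region W (reg a)}"

datatype ltl = LTrue | LAtom prp | LNot ltl | LAnd ltl ltl | LNext ltl | LUntil ltl ltl

primrec atoms :: "ltl \<Rightarrow> prp set" where
  "atoms LTrue = {}"
| "atoms (LAtom a) = {a}"
| "atoms (LNot f) = atoms f"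
| "atoms (LAnd f g) = atoms f \<union> atoms g"
| "atoms (LNext f) = atoms f"
| "atoms (LUntil f g) = atoms f \<union> atoms g"

primrec drop_conn :: "ltl \<Rightarrow> ltl" where
  "drop_conn LTrue = LTrue"
| "drop_conn (LAtom a) = LAtom (unconn a)"
| "drop_conn (LNot f) = LNot (drop_conn f)"
| "drop_conn (LAnd f g) = LAnd (drop_conn f) (drop_conn g)"
| "drop_conn (LNext f) = LNext (drop_conn f)"
| "drop_conn (LUntil f g) = LUntil (drop_conn f) (drop_conn g)"

text \<open>LTL over words of sets of atoms. The first argument is the polarity of the current
  position (\<open>True\<close> below an even number of negations): at negative positions the connector of
  an atom is ignored, because \<open>\<not>\<pi>\<^sup>\<chi>\<close> means \<open>\<not>\<pi>\<close>. On atoms without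
  connector the polarity is irrelevant and this is the usual semantics.\<close>

primrec holds :: "bool \<Rightarrow> prp set word \<Rightarrow> nat \<Rightarrow> ltl \<Rightarrow> bool" where
  "holds b w t LTrue = True"
| "holds b w t (LAtom a) = ((if b then a else unconn a) \<in> w t)"
| "holds b w t (LNot f) = (\<not> holds (\<not> b) w t f)"
| "holds b w t (LAnd f g) = (holds b w t f \<and> holds b w t g)"
| "holds b w t (LNext f) = holds b w (Suc t) f"
| "holds b w t (LUntil f g) =
     (\<exists>t'\<ge>t. holds b w t' g \<and> (\<forall>t''. t \<le> t'' \<and> t'' < t' \<longrightarrow> holds b w t'' f))"

definition formula_over :: "'c wspace \<Rightarrow> ltl \<Rightarrow> bool" where
  "formula_over W f \<longleftrightarrow> (\<forall>a\<in>atoms f. kind a < ntyp W \<and> reg a < nreg W)"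

definition valid :: "ltl \<Rightarrow> bool" where
  "valid f \<longleftrightarrow>
     (\<forall>a\<in>atoms f. \<forall>a'\<in>atoms f. conn a \<noteq> 0 \<and> conn a = conn a' \<longrightarrow> num a = num a' \<and> kind a = kind a')"

text \<open>\<open>\<rho> \<chi>\<close> is the team of robots that is to realise the connector \<open>\<chi> \<noteq> 0\<close>.\<close>

definition atom_true :: "'c wspace \<Rightarrow> (nat \<Rightarrow> nat set) \<Rightarrow> 'c config \<Rightarrow> prp \<Rightarrow> bool" where
  "atom_true W \<rho> s a \<longleftrightarrow>
     (if conn a = 0 then num a \<le> present W s a
      else \<rho> (conn a) \<subseteq> team W (kind a) \<and> card (\<rho> (conn a)) = num a \<and>
           (\<forall>r\<in>\<rho> (conn a). s r \<in> region W (reg a)))"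

definition trace :: "'c wspace \<Rightarrow> 'c config word \<Rightarrow> prp set word" where
  "trace W \<tau> t = {a. num a \<le> present W (\<tau> t) a}"

definition conn_trace :: "'c wspace \<Rightarrow> (nat \<Rightarrow> nat set) \<Rightarrow> 'c config word \<Rightarrow> prp set word" where
  "conn_trace W \<rho> \<tau> t = {a. atom_true W \<rho> (\<tau> t) a}"

definition satisfies :: "'c wspace \<Rightarrow> 'c config word \<Rightarrow> ltl \<Rightarrow> bool" where
  "satisfies W \<tau> f \<longleftrightarrow>
     holds True (trace W \<tau>) 0 (drop_conn f) \<and> (\<exists>\<rho>. holds True (conn_trace W \<rho> \<tau>) 0 f)"


section \<open>Automata with labels in DNF\<close>

text \<open>A clause is a set of literals, a label a set of clauses; thus \<open>\<top>\<close> is the empty clause and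
  \<open>\<bottom>\<close> the empty label. A label \<open>{}\<close> also stands for a missing edge.\<close>

datatype lit = Pos prp | Neg prp
type_synonym clause = "lit set"
type_synonym label = "clause set"

definition pos :: "clause \<Rightarrow> prp set" where "pos C = {a. Pos a \<in> C}"
definition neg :: "clause \<Rightarrow> prp set" where "neg C = {a. Neg a \<in> C}"

record 'v nba =
  verts :: "'v set"
  inits :: "'v set"
  accs :: "'v set"
  lab :: "'v \<Rightarrow> 'v \<Rightarrow> label"

definition models :: "prp set \<Rightarrow> clause \<Rightarrow> bool" where
  "models w C \<longleftrightarrow> pos C \<subseteq> w \<and> (\<forall>a\<in>neg C. unconn a \<notin> w)"

definition accepts :: "'v nba \<Rightarrow> prp set word \<Rightarrow> bool" where
  "accepts A w \<longleftrightarrow>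
     (\<exists>v. v 0 \<in> inits A \<and> (\<forall>t. \<exists>C\<in>lab A (v t) (v (Suc t)). models (w t) C) \<and>
          limit v \<inter> accs A \<noteq> {})"

definition nba_for :: "'v nba \<Rightarrow> ltl \<Rightarrow> bool" where
  "nba_for A f \<longleftrightarrow>
     finite (verts A) \<and> inits A \<subseteq> verts A \<and> accs A \<subseteq> verts A \<and>
     (\<forall>u v. lab A u v \<noteq> {} \<longrightarrow> u \<in> verts A \<and> v \<in> verts A) \<and>
     (\<forall>u v. finite (lab A u v) \<and>
        (\<forall>C\<in>lab A u v. finite C \<and> pos C \<union> neg C \<subseteq> atoms f \<union> unconn ` atoms f)) \<and>
     (\<forall>w. accepts A w \<longleftrightarrow> holds True w 0 f)"

text \<open>Pre-processing. In the absorption of positive literals, a literal without connector is first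
  compared with the other literals without connector (the largest survives); then each literal with a connector is
  taken into account once, so that the numbers of all of them are subtracted. Literals of
  a pre-processed clause with the same type and region therefore count different robots.\<close>

definition norm_neg :: "clause \<Rightarrow> clause" where
  "norm_neg C = Pos ` pos C \<union> Neg ` unconn ` neg C"

definition conn_sum :: "clause \<Rightarrow> prp \<Rightarrow> nat" where
  "conn_sum C a = (\<Sum>a' | a' \<in> pos C \<and> conn a' \<noteq> 0 \<and> kind a' = kind a \<and> reg a' = reg a. num a')"

definition pp_pos :: "clause \<Rightarrow> clause" where
  "pp_pos C = Neg ` neg C \<union> Pos ` {a \<in> pos C. conn a \<noteq> 0} \<union>
     {Pos (Prp (num a - conn_sum C a) (kind a) (reg a) 0) | a.
        a \<in> pos C \<and> conn a = 0 \<and>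
        (\<forall>a'\<in>pos C. conn a' = 0 \<and> kind a' = kind a \<and> reg a' = reg a \<longrightarrow> num a' \<le> num a) \<and>
        conn_sum C a < num a}"

definition pp_neg :: "clause \<Rightarrow> clause" where
  "pp_neg C = Pos ` pos C \<union>
     Neg ` {a \<in> neg C. \<not> (\<exists>a'\<in>neg C. kind a' = kind a \<and> reg a' = reg a \<and> num a' < num a)}"

text \<open>The flag \<open>ca\<close> adds the rule for collision avoidance.\<close>

definition infeasible :: "'c wspace \<Rightarrow> bool \<Rightarrow> clause \<Rightarrow> bool" where
  "infeasible W ca C \<longleftrightarrow>
     (\<exists>a\<in>pos C. \<exists>a'\<in>pos C. conn a \<noteq> 0 \<and> conn a' = conn a \<and> num a' = num a \<and> kind a' = kind a \<and>
        reg a' \<noteq> reg a) \<or>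
     (\<exists>a\<in>pos C. \<exists>a'\<in>neg C. kind a' = kind a \<and> reg a' = reg a \<and> num a' \<le> num a) \<or>
     (\<exists>j. card (team W j) < (\<Sum>a | a \<in> pos C \<and> kind a = j. num a)) \<or>
     (ca \<and> (\<exists>k. card (region W k) < (\<Sum>a | a \<in> pos C \<and> reg a = k. num a)))"

definition pp_label :: "'c wspace \<Rightarrow> bool \<Rightarrow> label \<Rightarrow> label" where
  "pp_label W ca \<gamma> = {C \<in> (pp_neg \<circ> pp_pos \<circ> norm_neg) ` \<gamma>. \<not> infeasible W ca C}"

text \<open>The automaton after pre-processing. A vertex \<open>v\<close> that is both initial and accepting is
  duplicated: \<open>(v, False)\<close> is the initial and \<open>(v, True)\<close> the accepting copy, both with all
  transitions of \<open>v\<close>. Any other vertex only occurs as \<open>(v, False)\<close>.\<close>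

definition prep :: "'c wspace \<Rightarrow> bool \<Rightarrow> 'v nba \<Rightarrow> ('v \<times> bool) nba" where
  "prep W ca A =
     \<lparr>verts = verts A \<times> {False} \<union> (inits A \<inter> accs A) \<times> {True},
      inits = inits A \<times> {False},
      accs = (accs A - inits A) \<times> {False} \<union> (inits A \<inter> accs A) \<times> {True},
      lab = (\<lambda>(u, i) (v, j).
        if (i \<longrightarrow> u \<in> inits A \<inter> accs A) \<and> (j \<longrightarrow> v \<in> inits A \<inter> accs A)
        then pp_label W ca (lab A u v) else {})\<rparr>"

definition implies :: "label \<Rightarrow> label \<Rightarrow> bool" where
  "implies \<gamma> \<gamma>' \<longleftrightarrow> (\<forall>C\<in>\<gamma>. \<exists>C'\<in>\<gamma>'. C' \<subseteq> C)"

definition implies_s :: "label \<Rightarrow> label \<Rightarrow> bool" where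
  "implies_s \<gamma> \<gamma>' \<longleftrightarrow> implies \<gamma> \<gamma>' \<and> (\<forall>C'\<in>\<gamma>'. \<exists>C\<in>\<gamma>. C' \<subseteq> C)"

text \<open>Satisfaction of a clause or label of the pre-processed automaton at a configuration.
  \<open>R a\<close> are the robots that make the positive literal \<open>a\<close> true; literals with the same type
  and region use different robots, and connectors are realised by \<open>\<rho>\<close>.\<close>

definition sat_clause ::
  "'c wspace \<Rightarrow> (nat \<Rightarrow> nat set) \<Rightarrow> 'c config \<Rightarrow> (prp \<Rightarrow> nat set) \<Rightarrow> clause \<Rightarrow> bool" where
  "sat_clause W \<rho> s R C \<longleftrightarrow>
     (\<forall>a\<in>pos C. R a \<subseteq> team W (kind a) \<and> card (R a) = num a \<and>
        (\<forall>r\<in>R a. s r \<in> region W (reg a)) \<and> (conn a \<noteq> 0 \<longrightarrow> R a = \<rho> (conn a))) \<and>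
     (\<forall>a\<in>pos C. \<forall>a'\<in>pos C. a \<noteq> a' \<and> kind a = kind a' \<and> reg a = reg a' \<longrightarrow> R a \<inter> R a' = {}) \<and>
     (\<forall>a\<in>neg C. present W s a < num a)"

definition sat_label :: "'c wspace \<Rightarrow> (nat \<Rightarrow> nat set) \<Rightarrow> 'c config \<Rightarrow> label \<Rightarrow> bool" where
  "sat_label W \<rho> s \<gamma> \<longleftrightarrow> (\<exists>C\<in>\<gamma>. \<exists>R. sat_clause W \<rho> s R C)"


section \<open>Pruning, relaxation and sub-automata\<close>

text \<open>Derived automata are given by their sets of edges (self-loops included); the labels are
  those of the pre-processed automaton, relaxed by \<^term>\<open>(`) pos\<close>. A clause of a relaxed label
  is thus a set of atoms.\<close>

type_synonym rclause = "prp set"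

definition relax :: "label \<Rightarrow> rclause set" where
  "relax \<gamma> = pos ` \<gamma>"

definition pruned_edges :: "'a nba \<Rightarrow> ('a \<times> 'a) set" where
  "pruned_edges G =
     (let F = accs G; I = inits G; \<gamma> = lab G;
          E1 = {(u, v). u \<in> verts G \<and> v \<in> verts G \<and> \<gamma> u v \<noteq> {}};
          V2 = {v \<in> verts G. (v, v) \<in> E1 \<or> v \<in> I \<union> F};
          E2 = E1 \<inter> V2 \<times> V2;
          E3 = {(u, v) \<in> E2. u \<noteq> v \<and> v \<notin> F \<longrightarrow> implies_s (\<gamma> u v) (\<gamma> v v)};
          V4 = {v \<in> V2. v \<in> I \<or> (\<exists>u\<in>V2. u \<noteq> v \<and> (u, v) \<in> E3\<^sup>+)}
      in E3 \<inter> V4 \<times> V4)"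

definition edges_of :: "'a list \<Rightarrow> ('a \<times> 'a) list" where
  "edges_of us = zip (butlast us) (tl us)"

text \<open>Paths use no self-loops and have at least one edge. If \<open>v0 = va\<close>, a path is a closed walk
  that meets \<open>va\<close> only at its ends, and a simple path is a simple cycle.\<close>

definition path_between :: "('a \<times> 'a) set \<Rightarrow> 'a \<Rightarrow> 'a \<Rightarrow> 'a list \<Rightarrow> bool" where
  "path_between E v0 va us \<longleftrightarrow>
     2 \<le> length us \<and> hd us = v0 \<and> last us = va \<and> va \<notin> set (butlast (tl us)) \<and>
     (\<forall>(u, v)\<in>set (edges_of us). (u, v) \<in> E \<and> u \<noteq> v)"

definition simple_path :: "('a \<times> 'a) set \<Rightarrow> 'a \<Rightarrow> 'a \<Rightarrow> 'a list \<Rightarrow> bool" where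
  "simple_path E v0 va us \<longleftrightarrow>
     path_between E v0 va us \<and> distinct (butlast us) \<and> distinct (tl us)"

definition restrict_edges :: "('a \<times> 'a) set \<Rightarrow> 'a set \<Rightarrow> ('a \<times> 'a) set" where
  "restrict_edges E V = E \<inter> V \<times> V"

text \<open>Applied after the removal of other initial and accepting vertices; \<open>sat\<close> tests labels at the
  initial configuration.\<close>

definition sub_edges ::
  "('a \<Rightarrow> 'a \<Rightarrow> label) \<Rightarrow> (label \<Rightarrow> bool) \<Rightarrow> 'a \<Rightarrow> 'a \<Rightarrow> ('a \<times> 'a) set \<Rightarrow> ('a \<times> 'a) set" where
  "sub_edges \<gamma> sat v0 va E =
     (let E1 = (if sat (\<gamma> v0 v0) then E else E - {(v0, v0)});
          E2 = (if (v0, v0) \<in> E1 then E1 else {(u, v) \<in> E1. u = v0 \<longrightarrow> sat (\<gamma> u v)});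
          E3 = (if va = v0 then E2 else {(u, v) \<in> E2. u = va \<longrightarrow> v = va})
      in restrict_edges E3 (\<Union>us\<in>{us. path_between E3 v0 va us}. set us))"

definition rmodels :: "prp set \<Rightarrow> rclause set \<Rightarrow> bool" where
  "rmodels w \<gamma> \<longleftrightarrow> (\<exists>p\<in>\<gamma>. p \<subseteq> w)"

text \<open>In the definition of composite edges, equality of labels is logical equivalence.\<close>

definition composite :: "('a \<Rightarrow> 'a \<Rightarrow> label) \<Rightarrow> 'a \<Rightarrow> ('a \<times> 'a) set \<Rightarrow> 'a \<times> 'a \<Rightarrow> bool" where
  "composite \<gamma> va E = (\<lambda>(v1, v3). v1 \<noteq> v3 \<and>
     (\<exists>v2. v2 \<noteq> v1 \<and> v2 \<noteq> v3 \<and> (v1, v2) \<in> E \<and> (v2, v3) \<in> E \<and>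
        (\<forall>w. rmodels w (relax (\<gamma> v1 v3)) \<longleftrightarrow>
               rmodels w (relax (\<gamma> v1 v2)) \<and> rmodels w (relax (\<gamma> v2 v3))) \<and>
        (v3 = va \<longrightarrow> {} \<in> \<gamma> v3 v3)))"

definition sub_minus ::
  "('a \<Rightarrow> 'a \<Rightarrow> label) \<Rightarrow> (label \<Rightarrow> bool) \<Rightarrow> 'a \<Rightarrow> 'a \<Rightarrow> ('a \<times> 'a) set \<Rightarrow> ('a \<times> 'a) set" where
  "sub_minus \<gamma> sat v0 va E =
     (let Es = sub_edges \<gamma> sat v0 va E in {e \<in> Es. \<not> composite \<gamma> va Es e})"

definition prefix_graph :: "'a nba \<Rightarrow> 'a \<Rightarrow> 'a \<Rightarrow> ('a \<times> 'a) set" where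
  "prefix_graph G v0 va =
     restrict_edges (pruned_edges G) (verts G - (inits G \<union> accs G - {v0, va}))"

text \<open>\<open>\<gamma>in\<close> is the label of the last edge of the prefix.\<close>

definition suffix_graph :: "'a nba \<Rightarrow> 'a \<Rightarrow> label \<Rightarrow> ('a \<times> 'a) set" where
  "suffix_graph G va \<gamma>in =
     (let E = pruned_edges G;
          V = verts G - (accs G - {va}) - {v \<in> inits G. (v, v) \<notin> E}
      in {(u, v) \<in> restrict_edges E V.
            (u, v) \<noteq> (va, va) \<and> (u = va \<or> v = va \<longrightarrow> implies \<gamma>in (lab G u v))})"


section \<open>Subtasks and posets\<close>

text \<open>A subtask is represented by an edge.\<close>

definition edge_label :: "('a \<Rightarrow> 'a \<Rightarrow> label) \<Rightarrow> 'a \<times> 'a \<Rightarrow> rclause set" where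
  "edge_label \<gamma> e = relax (\<gamma> (fst e) (snd e))"

definition start_label :: "('a \<Rightarrow> 'a \<Rightarrow> label) \<Rightarrow> ('a \<times> 'a) set \<Rightarrow> 'a \<times> 'a \<Rightarrow> rclause set" where
  "start_label \<gamma> E e = (if (fst e, fst e) \<in> E then relax (\<gamma> (fst e) (fst e)) else {})"

definition same_subtask ::
  "('a \<Rightarrow> 'a \<Rightarrow> label) \<Rightarrow> ('a \<times> 'a) set \<Rightarrow> 'a \<Rightarrow> 'a \<Rightarrow> 'a \<times> 'a \<Rightarrow> 'a \<times> 'a \<Rightarrow> bool" where
  "same_subtask \<gamma> E v0 va e e' \<longleftrightarrow> e = e' \<or>
     \<not> (\<exists>us. path_between E v0 va us \<and> {e, e'} \<subseteq> set (edges_of us)) \<and>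
     edge_label \<gamma> e = edge_label \<gamma> e' \<and> start_label \<gamma> E e = start_label \<gamma> E e'"

text \<open>A linear order is encoded as a list without repetitions. A class of simple paths is given by
  the edge set \<open>X\<close> of one of its members; other members contribute the order in which their
  edges, up to identification, enumerate \<open>X\<close>.\<close>

definition path_orders ::
  "('a \<Rightarrow> 'a \<Rightarrow> label) \<Rightarrow> ('a \<times> 'a) set \<Rightarrow> 'a \<Rightarrow> 'a \<Rightarrow> ('a \<times> 'a) set \<Rightarrow> ('a \<times> 'a) list set" where
  "path_orders \<gamma> E v0 va X =
     {xs. distinct xs \<and> set xs = X \<and>
        (\<exists>us. simple_path E v0 va us \<and> list_all2 (same_subtask \<gamma> E v0 va) xs (edges_of us))}"

definition strict_order_on :: "'e set \<Rightarrow> ('e \<times> 'e) set \<Rightarrow> bool" where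
  "strict_order_on X P \<longleftrightarrow> P \<subseteq> X \<times> X \<and> irrefl P \<and> trans P"

definition lin_exts :: "'e set \<Rightarrow> ('e \<times> 'e) set \<Rightarrow> 'e list set" where
  "lin_exts X P = {xs. distinct xs \<and> set xs = X \<and> sorted_wrt (\<lambda>e e'. (e', e) \<notin> P) xs}"

definition list_order :: "'e list \<Rightarrow> ('e \<times> 'e) set" where
  "list_order xs = {(xs ! i, xs ! j) | i j. i < j \<and> j < length xs}"

definition max_poset :: "'e set \<Rightarrow> 'e list set \<Rightarrow> ('e \<times> 'e) set \<Rightarrow> bool" where
  "max_poset X \<Xi> P \<longleftrightarrow> strict_order_on X P \<and> lin_exts X P \<subseteq> \<Xi> \<and>
     (\<forall>Q. strict_order_on X Q \<and> lin_exts X Q \<subseteq> \<Xi> \<longrightarrow> card (lin_exts X Q) \<le> card (lin_exts X P))"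

definition admissible_poset :: "'e set \<Rightarrow> 'e list set \<Rightarrow> ('e \<times> 'e) set \<Rightarrow> bool" where
  "admissible_poset X \<Xi> P \<longleftrightarrow>
     (\<exists>Pm. max_poset X \<Xi> Pm \<and> (P = Pm \<or> (\<exists>xs\<in>\<Xi> - lin_exts X Pm. P = list_order xs)))"


section \<open>Routing graph\<close>

text \<open>Clauses of a subtask carry a flag marking the extra clause of the suffix. For \<open>extra = Some (c, f)\<close>,
  \<open>c\<close> is the extra clause and \<open>f q b\<close> the robot assigned to its \<open>b\<close>-th vertex for literal \<open>q\<close>.\<close>

type_synonym cidx = "rclause \<times> bool"

record ('a, 'c) problem =
  tasks :: "('a \<times> 'a) set"
  prec :: "(('a \<times> 'a) \<times> ('a \<times> 'a)) set"
  full_lab :: "'a \<Rightarrow> 'a \<Rightarrow> label"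
  graph :: "('a \<times> 'a) set"
  start :: "'c config"
  extra :: "(rclause \<times> (prp \<Rightarrow> nat \<Rightarrow> nat)) option"

definition smaller :: "('a, 'c) problem \<Rightarrow> 'a \<times> 'a \<Rightarrow> ('a \<times> 'a) set" where
  "smaller P e = {e' \<in> tasks P. (e', e) \<in> prec P}"

definition covered_by :: "('a, 'c) problem \<Rightarrow> 'a \<times> 'a \<Rightarrow> ('a \<times> 'a) set" where
  "covered_by P e =
     {e' \<in> smaller P e. \<not> (\<exists>d\<in>tasks P. (e', d) \<in> prec P \<and> (d, e) \<in> prec P)}"

definition covering :: "('a, 'c) problem \<Rightarrow> 'a \<times> 'a \<Rightarrow> ('a \<times> 'a) set" where
  "covering P e = {e' \<in> tasks P. e \<in> covered_by P e'}"

definition incomp :: "('a, 'c) problem \<Rightarrow> 'a \<times> 'a \<Rightarrow> ('a \<times> 'a) set" where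
  "incomp P e = {e' \<in> tasks P. e' \<noteq> e \<and> (e, e') \<notin> prec P \<and> (e', e) \<notin> prec P}"

definition firsts :: "('a, 'c) problem \<Rightarrow> ('a \<times> 'a) set" where
  "firsts P = {e \<in> tasks P. covered_by P e = {}}"

definition lasts :: "('a, 'c) problem \<Rightarrow> ('a \<times> 'a) set" where
  "lasts P = {e \<in> tasks P. covering P e = {}}"

text \<open>The Boolean is \<open>True\<close> for the edge label and \<open>False\<close> for the starting vertex label.\<close>

definition clauses :: "('a, 'c) problem \<Rightarrow> 'a \<times> 'a \<Rightarrow> bool \<Rightarrow> cidx set" where
  "clauses P e a =
     (if a
      then edge_label (full_lab P) e \<times> {False} \<union>
        (case extra P of None \<Rightarrow> {} | Some (c, f) \<Rightarrow> if e \<in> lasts P then {(c, True)} else {})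
      else start_label (full_lab P) (graph P) e \<times> {False})"

definition top_label :: "('a, 'c) problem \<Rightarrow> 'a \<times> 'a \<Rightarrow> bool \<Rightarrow> bool" where
  "top_label P e a \<longleftrightarrow> (\<exists>p\<in>clauses P e a. fst p = {})"

definition proper_label :: "('a, 'c) problem \<Rightarrow> 'a \<times> 'a \<Rightarrow> bool \<Rightarrow> bool" where
  "proper_label P e a \<longleftrightarrow> clauses P e a \<noteq> {} \<and> \<not> top_label P e a"

datatype 'a rvert =
    Init nat
  | Task "'a \<times> 'a" bool cidx prp nat

definition lit_verts :: "'a \<times> 'a \<Rightarrow> bool \<Rightarrow> cidx \<Rightarrow> prp \<Rightarrow> 'a rvert set" where
  "lit_verts e a p q = Task e a p q ` {..<num q}"

definition clause_verts :: "'a \<times> 'a \<Rightarrow> bool \<Rightarrow> cidx \<Rightarrow> 'a rvert set" where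
  "clause_verts e a p = (\<Union>q\<in>fst p. lit_verts e a p q)"

definition task_verts :: "('a, 'c) problem \<Rightarrow> 'a rvert set" where
  "task_verts P =
     (\<Union>e\<in>tasks P. \<Union>a\<in>{a. proper_label P e a}. \<Union>p\<in>clauses P e a. clause_verts e a p)"

fun loc :: "'c wspace \<Rightarrow> ('a, 'c) problem \<Rightarrow> 'a rvert \<Rightarrow> 'c set" where
  "loc W P (Init r) = {start P r}"
| "loc W P (Task e a p q b) = region W (reg q)"

fun rob :: "'c wspace \<Rightarrow> ('a, 'c) problem \<Rightarrow> 'a rvert \<Rightarrow> nat set" where
  "rob W P (Init r) = {r}"
| "rob W P (Task e a p q b) = (if snd p then {snd (the (extra P)) q b} else team W (kind q))"

text \<open>\<open>link i b i' b'\<close>: one-to-one connections between literals with equal numbers, and all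
  connections otherwise.\<close>

definition link :: "nat \<Rightarrow> nat \<Rightarrow> nat \<Rightarrow> nat \<Rightarrow> bool" where
  "link i b i' b' \<longleftrightarrow> (i = i' \<longrightarrow> b = b')"

definition clause_from ::
  "('a, 'c) problem \<Rightarrow> 'a \<times> 'a \<Rightarrow> rclause \<Rightarrow> 'a \<times> 'a \<Rightarrow> rclause \<Rightarrow> bool" where
  "clause_from P e c e' c' \<longleftrightarrow>
     (\<exists>C\<in>full_lab P (fst e) (fst e). \<exists>C'\<in>full_lab P (fst e') (snd e').
        pos C = c \<and> pos C' = c' \<and> C \<subseteq> C')"

fun route :: "'c wspace \<Rightarrow> ('a, 'c) problem \<Rightarrow> 'a rvert \<Rightarrow> 'a rvert \<Rightarrow> bool" where
  "route W P u (Init r) = False"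
| "route W P (Init r) (Task e a p q b) = (r \<in> team W (kind q) \<and> (a \<or> covered_by P e = {}))"
| "route W P (Task e' a' p' q' b') (Task e a p q b) =
     (\<not> snd p' \<and>
      (if a
       then (e' \<in> smaller P e \<union> incomp P e \<or> e' = e \<and> \<not> a') \<and> kind q' = kind q \<and>
            (snd p \<or> link (num q') b' (num q) b)
       else a' \<and> e' \<in> covered_by P e \<union> incomp P e \<and> clause_from P e (fst p) e' (fst p') \<and>
            q' = q \<and> b' = b))"

definition rverts :: "'c wspace \<Rightarrow> ('a, 'c) problem \<Rightarrow> 'a rvert set" where
  "rverts W P = Init ` robots W \<union> task_verts P"

definition redges :: "'c wspace \<Rightarrow> ('a, 'c) problem \<Rightarrow> ('a rvert \<times> 'a rvert) set" where
  "redges W P = {(u, v). u \<in> rverts W P \<and> v \<in> rverts W P \<and> route W P u v}"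

text \<open>Shortest travel time and cost between two sets of cells. The travel time is \<open>\<infinity>\<close> if there
  is no connection.\<close>

definition travel_time :: "'c wspace \<Rightarrow> 'c set \<Rightarrow> 'c set \<Rightarrow> enat" where
  "travel_time W U V = Inf {enat n | n. \<exists>c\<in>U. \<exists>c'\<in>V. (c, c') \<in> adj W ^^ n}"

definition travel_cost :: "'c wspace \<Rightarrow> 'c set \<Rightarrow> 'c set \<Rightarrow> real" where
  "travel_cost W U V =
     Inf {\<Sum>(c, c')\<leftarrow>edges_of cs. cost W c c' | cs.
            cs \<noteq> [] \<and> hd cs \<in> U \<and> last cs \<in> V \<and> set (edges_of cs) \<subseteq> adj W}"


section \<open>MILP\<close>

record 'a sol =
  xvar :: "'a rvert \<Rightarrow> 'a rvert \<Rightarrow> nat \<Rightarrow> nat"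
  tminus :: "'a rvert \<Rightarrow> nat \<Rightarrow> nat"
  tplus :: "'a rvert \<Rightarrow> nat \<Rightarrow> nat"
  bcl :: "'a \<times> 'a \<Rightarrow> bool \<Rightarrow> cidx \<Rightarrow> nat"
  te :: "'a \<times> 'a \<Rightarrow> nat"
  bnext :: "'a \<times> 'a \<Rightarrow> 'a \<times> 'a \<Rightarrow> nat"
  bafter :: "'a \<times> 'a \<Rightarrow> 'a \<times> 'a \<Rightarrow> nat"
  bfirst :: "'a \<times> 'a \<Rightarrow> nat"
  blast_task :: "'a \<times> 'a \<Rightarrow> nat"

text \<open>\<open>bnext s e e'\<close> is the binary \<open>b\<close> with subscript \<open>ee'\<close> (\<open>e'\<close> is completed right after \<open>e\<close>),
  \<open>bafter s e e'\<close> the one with subscript \<open>e\<close> and superscript \<open>e'\<close> (\<open>e\<close> is completed after \<open>e'\<close>).\<close>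

definition inflow :: "'c wspace \<Rightarrow> ('a, 'c) problem \<Rightarrow> 'a sol \<Rightarrow> 'a rvert \<Rightarrow> nat \<Rightarrow> nat" where
  "inflow W P s v r = (\<Sum>u | (u, v) \<in> redges W P. xvar s u v r)"

definition outflow :: "'c wspace \<Rightarrow> ('a, 'c) problem \<Rightarrow> 'a sol \<Rightarrow> 'a rvert \<Rightarrow> nat \<Rightarrow> nat" where
  "outflow W P s v r = (\<Sum>w | (v, w) \<in> redges W P. xvar s v w r)"

definition visits :: "'c wspace \<Rightarrow> ('a, 'c) problem \<Rightarrow> 'a sol \<Rightarrow> 'a rvert \<Rightarrow> nat" where
  "visits W P s v = (\<Sum>r\<in>rob W P v. inflow W P s v r)"

definition Tminus :: "'c wspace \<Rightarrow> ('a, 'c) problem \<Rightarrow> 'a sol \<Rightarrow> 'a rvert \<Rightarrow> nat" where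
  "Tminus W P s v = (\<Sum>r\<in>rob W P v. tminus s v r)"

definition Tplus :: "'c wspace \<Rightarrow> ('a, 'c) problem \<Rightarrow> 'a sol \<Rightarrow> 'a rvert \<Rightarrow> nat" where
  "Tplus W P s v = (\<Sum>r\<in>rob W P v. tplus s v r)"

definition binary_vars :: "'c wspace \<Rightarrow> ('a, 'c) problem \<Rightarrow> 'a sol \<Rightarrow> bool" where
  "binary_vars W P s \<longleftrightarrow>
     (\<forall>u v r. xvar s u v r \<le> 1 \<and> (xvar s u v r \<noteq> 0 \<longrightarrow> (u, v) \<in> redges W P \<and> r \<in> rob W P v)) \<and>
     (\<forall>e a p. bcl s e a p \<le> 1) \<and> (\<forall>e e'. bnext s e e' \<le> 1) \<and> (\<forall>e e'. bafter s e e' \<le> 1) \<and>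
     (\<forall>e. bfirst s e \<le> 1) \<and> (\<forall>e. blast_task s e \<le> 1)"

definition flow_ok :: "'c wspace \<Rightarrow> nat \<Rightarrow> ('a, 'c) problem \<Rightarrow> 'a sol \<Rightarrow> bool" where
  "flow_ok W M P s \<longleftrightarrow>
     (\<forall>v\<in>task_verts P. visits W P s v \<le> 1 \<and>
        (\<forall>r\<in>robots W. outflow W P s v r \<le> inflow W P s v r \<and>
           tminus s v r \<le> M * inflow W P s v r \<and> tplus s v r \<le> M * inflow W P s v r)) \<and>
     (\<forall>r\<in>robots W. outflow W P s (Init r) r \<le> 1 \<and>
        (\<forall>r'\<in>robots W. (r' \<noteq> r \<longrightarrow> outflow W P s (Init r) r' = 0) \<and>
           tminus s (Init r) r' = 0 \<and> tplus s (Init r) r' = 0)) \<and>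
     (\<forall>v\<in>task_verts P. \<forall>r\<in>robots W.
        case v of Init _ \<Rightarrow> True
        | Task e a p q b \<Rightarrow> if a then tminus s v r = tplus s v r else tminus s v r \<le> tplus s v r)"

fun delay :: "('a, 'c) problem \<Rightarrow> 'a rvert \<Rightarrow> 'a rvert \<Rightarrow> nat" where
  "delay P (Task e a p q b) (Task e' a' p' q' b') = (if e' \<in> incomp P e then 1 else 0)"
| "delay P _ _ = 0"

definition travel_ok :: "'c wspace \<Rightarrow> nat \<Rightarrow> ('a, 'c) problem \<Rightarrow> 'a sol \<Rightarrow> bool" where
  "travel_ok W M P s \<longleftrightarrow>
     (\<forall>(u, v)\<in>redges W P. \<forall>r\<in>rob W P v.
        enat (tplus s u r) + (travel_time W (loc W P u) (loc W P v) + enat (delay P u v)) * enat (xvar s u v r)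
          \<le> enat (tminus s v r + M * (1 - xvar s u v r)))"

definition label_ok :: "'c wspace \<Rightarrow> ('a, 'c) problem \<Rightarrow> 'a sol \<Rightarrow> bool" where
  "label_ok W P s \<longleftrightarrow>
     (\<forall>e\<in>tasks P. \<forall>a. proper_label P e a \<longrightarrow>
        (\<Sum>p\<in>clauses P e a. bcl s e a p) = 1 \<and>
        (\<forall>p\<in>clauses P e a.
           (\<Sum>v\<in>clause_verts e a p. visits W P s v) = bcl s e a p * (\<Sum>q\<in>fst p. num q)) \<and>
        (a \<longrightarrow> (\<forall>p\<in>clauses P e a. \<forall>u\<in>clause_verts e a p. \<forall>v\<in>clause_verts e a p.
                 Tminus W P s u = Tminus W P s v)))"

text \<open>In the first constraint \<open>f\<close> picks the arbitrary vertex of each clause; a clause has no vertices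
  only if all numbers in it are 0.\<close>

definition completion_ok :: "'c wspace \<Rightarrow> nat \<Rightarrow> ('a, 'c) problem \<Rightarrow> 'a sol \<Rightarrow> bool" where
  "completion_ok W M P s \<longleftrightarrow>
     (\<forall>e\<in>tasks P.
        (proper_label P e True \<longrightarrow>
           (let D = {p \<in> clauses P e True. clause_verts e True p \<noteq> {}} in
            \<forall>f. (\<forall>p\<in>D. f p \<in> clause_verts e True p) \<longrightarrow>
                te s e = (\<Sum>p\<in>D. Tminus W P s (f p)))) \<and>
        (proper_label P e False \<longrightarrow>
           (\<forall>p\<in>clauses P e False. \<forall>v\<in>clause_verts e False p.
              Tminus W P s v \<le> te s e \<and>
              te s e \<le> Tplus W P s v + 1 + M * (1 - bcl s e False p))) \<and>
        (clauses P e False = {} \<longrightarrow> te s e = 0) \<and>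
        (\<forall>e'\<in>covered_by P e. te s e' + 1 \<le> te s e))"

definition order_ok :: "nat \<Rightarrow> ('a, 'c) problem \<Rightarrow> 'a sol \<Rightarrow> bool" where
  "order_ok M P s \<longleftrightarrow>
     (\<forall>e\<in>tasks P. \<forall>e'\<in>tasks P. e \<noteq> e' \<longrightarrow>
        bafter s e e' + bafter s e' e = 1 \<and>
        int M * (int (bafter s e e') - 1) \<le> int (te s e) - int (te s e') \<and>
        int (te s e) - int (te s e') \<le> int M * int (bafter s e e') - 1)"

definition next_ok :: "'c wspace \<Rightarrow> nat \<Rightarrow> ('a, 'c) problem \<Rightarrow> 'a sol \<Rightarrow> bool" where
  "next_ok W M P s \<longleftrightarrow>
     (\<forall>e\<in>tasks P.
        (if covering P e \<noteq> {} then (\<Sum>e'\<in>covering P e \<union> incomp P e. bnext s e e') = 1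
         else (\<Sum>e'\<in>incomp P e. bnext s e e') \<le> 1 \<and>
              int (card (incomp P e)) - int (\<Sum>e'\<in>incomp P e. bafter s e e')
                \<le> int M * int (\<Sum>e'\<in>incomp P e. bnext s e e') \<and>
              int (\<Sum>e'\<in>incomp P e. bnext s e e')
                \<le> int M * (int (card (incomp P e)) - int (\<Sum>e'\<in>incomp P e. bafter s e e'))) \<and>
        (\<forall>e'\<in>covering P e \<union> incomp P e.
           te s e + 1 \<le> te s e' + M * (1 - bnext s e e') \<and>
           (proper_label P e' False \<longrightarrow>
              (\<forall>p\<in>clauses P e' False. \<forall>v\<in>clause_verts e' False p.
                 Tminus W P s v \<le> te s e + 1 + M * (1 - bnext s e e')))))"

definition prev_ok :: "nat \<Rightarrow> ('a, 'c) problem \<Rightarrow> 'a sol \<Rightarrow> bool" where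
  "prev_ok M P s \<longleftrightarrow>
     (\<forall>e\<in>tasks P.
        if covered_by P e \<noteq> {} then (\<Sum>e'\<in>covered_by P e \<union> incomp P e. bnext s e' e) = 1
        else (\<Sum>e'\<in>incomp P e. bnext s e' e) \<le> 1 \<and>
             (\<Sum>e'\<in>incomp P e. bafter s e e') \<le> M * (\<Sum>e'\<in>incomp P e. bnext s e' e) \<and>
             (\<Sum>e'\<in>incomp P e. bnext s e' e) \<le> M * (\<Sum>e'\<in>incomp P e. bafter s e e'))"

definition first_ok :: "'c wspace \<Rightarrow> nat \<Rightarrow> ('a, 'c) problem \<Rightarrow> 'a sol \<Rightarrow> bool" where
  "first_ok W M P s \<longleftrightarrow>
     (\<forall>e\<in>firsts P.
        let \<beta> = (\<Sum>e'\<in>firsts P - {e}. bafter s e e') in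
        \<beta> \<le> M * (1 - bfirst s e) \<and> 1 - bfirst s e \<le> M * \<beta> \<and>
        (proper_label P e False \<longrightarrow>
           (\<forall>p\<in>clauses P e False.
              (\<forall>v\<in>clause_verts e False p. Tminus W P s v \<le> M * (\<beta> + 1 - bcl s e False p)) \<and>
              (\<Sum>v\<in>clause_verts e False p. \<Sum>u | (u, v) \<in> redges W P \<and> u \<in> task_verts P.
                 \<Sum>r\<in>rob W P v. xvar s u v r) \<le> M * (1 - bfirst s e) \<and>
              (\<Sum>v\<in>clause_verts e False p. \<Sum>u | (u, v) \<in> redges W P \<and> u \<notin> task_verts P.
                 \<Sum>r\<in>rob W P v. xvar s u v r) \<le> M * bfirst s e)))"

definition selected :: "('a, 'c) problem \<Rightarrow> 'a sol \<Rightarrow> 'a \<times> 'a \<Rightarrow> bool \<Rightarrow> cidx \<Rightarrow> bool" where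
  "selected P s e a p \<longleftrightarrow>
     e \<in> tasks P \<and> proper_label P e a \<and> p \<in> clauses P e a \<and> bcl s e a p = 1"

definition connector_ok :: "'c wspace \<Rightarrow> ('a, 'c) problem \<Rightarrow> 'a sol \<Rightarrow> bool" where
  "connector_ok W P s \<longleftrightarrow>
     (\<forall>e a p e' a' p'. selected P s e a p \<and> selected P s e' a' p' \<longrightarrow>
        (\<forall>q\<in>fst p. \<forall>q'\<in>fst p'.
           conn q \<noteq> 0 \<and> conn q' = conn q \<and> num q' = num q \<and> kind q' = kind q \<longrightarrow>
           (\<forall>b<num q. \<forall>r. inflow W P s (Task e a p q b) r = inflow W P s (Task e' a' p' q' b) r)))"

definition milp_base :: "'c wspace \<Rightarrow> nat \<Rightarrow> ('a, 'c) problem \<Rightarrow> 'a sol \<Rightarrow> bool" where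
  "milp_base W M P s \<longleftrightarrow>
     binary_vars W P s \<and> flow_ok W M P s \<and> travel_ok W M P s \<and> label_ok W P s \<and>
     completion_ok W M P s \<and> order_ok M P s \<and> next_ok W M P s \<and> prev_ok M P s \<and>
     first_ok W M P s \<and> connector_ok W P s"

definition prefix_last_ok :: "('a, 'c) problem \<Rightarrow> 'a \<times> 'a \<Rightarrow> cidx \<Rightarrow> 'a sol \<Rightarrow> bool" where
  "prefix_last_ok P el pl s \<longleftrightarrow>
     el \<in> lasts P \<and> (\<forall>e'\<in>tasks P - {el}. bafter s el e' = 1) \<and>
     (proper_label P el True \<longrightarrow> pl \<in> clauses P el True \<and> bcl s el True pl = 1)"

definition suffix_last_ok :: "'c wspace \<Rightarrow> nat \<Rightarrow> ('a, 'c) problem \<Rightarrow> 'a sol \<Rightarrow> bool" where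
  "suffix_last_ok W M P s \<longleftrightarrow>
     (\<Sum>e\<in>lasts P. blast_task s e) = 1 \<and>
     (\<forall>e\<in>lasts P.
        let z = int (card (lasts P)) - 1; m = int (\<Sum>e'\<in>lasts P - {e}. bafter s e e') in
        1 + int M * (m - z) \<le> int (blast_task s e) \<and>
        int (blast_task s e) \<le> 1 + int M * (z - m)) \<and>
     (\<forall>e\<in>lasts P. proper_label P e True \<longrightarrow>
        (\<forall>(c, f)\<in>set_option (extra P). \<forall>q\<in>c.
           (\<Sum>b<num q. inflow W P s (Task e True (c, True) q b) (f q b)) = num q * blast_task s e))"

definition objective :: "'c wspace \<Rightarrow> real \<Rightarrow> ('a, 'c) problem \<Rightarrow> 'a sol \<Rightarrow> real" where
  "objective W \<alpha> P s =
     \<alpha> * (\<Sum>(u, v)\<in>redges W P. \<Sum>r\<in>rob W P v.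
             travel_cost W (loc W P u) (loc W P v) * real (xvar s u v r))
     + (1 - \<alpha>) * (\<Sum>e\<in>tasks P. real (te s e))"

text \<open>The robots assigned to a literal of a selected clause, and the connectors used by
  selected clauses together with the robots realising them.\<close>

definition essential ::
  "'c wspace \<Rightarrow> ('a, 'c) problem \<Rightarrow> 'a sol \<Rightarrow> 'a \<times> 'a \<Rightarrow> bool \<Rightarrow> cidx \<Rightarrow> prp \<Rightarrow> nat set" where
  "essential W P s e a p q = {r. \<exists>b<num q. inflow W P s (Task e a p q b) r = 1}"

definition conn_used :: "'c wspace \<Rightarrow> ('a, 'c) problem \<Rightarrow> 'a sol \<Rightarrow> (nat \<times> nat set) set" where
  "conn_used W P s =
     {(conn q, essential W P s e a p q) | e a p q. selected P s e a p \<and> q \<in> fst p \<and> conn q \<noteq> 0}"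


section \<open>Generalized multi-robot path planning\<close>

record impl =
  collision :: bool
  simultaneous :: bool
  partial :: bool

text \<open>Targets are pairs of a robot and a set of cells. \<open>waypoint Q r U\<close>: robot \<open>r\<close> is needed for later
  subtasks and its next waypoint is \<open>U\<close>.\<close>

record 'c gmrpp =
  source :: "'c config"
  keep_targets :: "(nat \<times> 'c set) set"
  end_targets :: "(nat \<times> 'c set) set"
  keep_negs :: "prp set"
  end_negs :: "prp set"
  waypoint :: "nat \<Rightarrow> 'c set \<Rightarrow> bool"

definition with_target :: "'c gmrpp \<Rightarrow> nat set" where
  "with_target Q = fst ` (keep_targets Q \<union> end_targets Q)"

definition negs :: "'c gmrpp \<Rightarrow> prp set" where
  "negs Q = keep_negs Q \<union> end_negs Q"

text \<open>Simultaneous execution: \<open>g\<close> gives the intermediate target cells.\<close>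

definition intermediate_ok :: "'c wspace \<Rightarrow> impl \<Rightarrow> 'c gmrpp \<Rightarrow> (nat \<rightharpoonup> 'c) \<Rightarrow> bool" where
  "intermediate_ok W I Q g \<longleftrightarrow>
     (\<not> simultaneous I \<longrightarrow> g = Map.empty) \<and>
     (\<forall>r c. g r = Some c \<longrightarrow>
        r \<in> robots W \<and> r \<notin> with_target Q \<and>
        (\<exists>U. waypoint Q r U \<and> travel_time W {source Q r} U \<noteq> \<infinity> \<and>
           travel_time W {source Q r} {c} + travel_time W {c} U = travel_time W {source Q r} U) \<and>
        (\<forall>a\<in>negs Q. r \<in> team W (kind a) \<longrightarrow> c \<notin> region W (reg a)))"

text \<open>Partial execution: \<open>Rm a\<close> are the robots put in \<open>\<R>\<^sup>-\<close> because of the negative literal \<open>a\<close>.\<close>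

definition rminus_ok :: "'c wspace \<Rightarrow> 'c gmrpp \<Rightarrow> (prp \<Rightarrow> nat set) \<Rightarrow> bool" where
  "rminus_ok W Q Rm \<longleftrightarrow>
     (\<forall>a\<in>negs Q. let i' = present W (source Q) a in
        if i' < num a then Rm a = {}
        else Rm a \<subseteq> {r \<in> team W (kind a). source Q r \<in> region W (reg a)} \<and>
             card (Rm a) = i' - num a + 1)"

definition moving ::
  "'c wspace \<Rightarrow> impl \<Rightarrow> 'c gmrpp \<Rightarrow> (nat \<rightharpoonup> 'c) \<Rightarrow> (prp \<Rightarrow> nat set) \<Rightarrow> nat set" where
  "moving W I Q g Rm =
     (if partial I then with_target Q \<union> dom g \<union> (\<Union>a\<in>negs Q. Rm a) else robots W)"

definition bound :: "'c wspace \<Rightarrow> impl \<Rightarrow> 'c gmrpp \<Rightarrow> prp \<Rightarrow> nat" where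
  "bound W I Q a =
     (let i' = present W (source Q) a in
      if \<not> partial I then num a else if i' < num a then num a - i' else 1)"

definition gmrpp_feasible ::
  "'c wspace \<Rightarrow> impl \<Rightarrow> 'c gmrpp \<Rightarrow> (nat \<rightharpoonup> 'c) \<Rightarrow> (prp \<Rightarrow> nat set) \<Rightarrow> nat \<Rightarrow> 'c config list \<Rightarrow> bool" where
  "gmrpp_feasible W I Q g Rm T \<sigma> \<longleftrightarrow>
     (let Mv = moving W I Q g Rm;
          neg_ok = (\<lambda>t a. card {r \<in> Mv \<inter> team W (kind a). (\<sigma> ! t) r \<in> region W (reg a)} < bound W I Q a)
      in
      length \<sigma> = Suc T \<and> \<sigma> ! 0 = source Q \<and> set \<sigma> \<subseteq> configs W \<and>
      (\<forall>t<T. legal_step W (\<sigma> ! t) (\<sigma> ! Suc t)) \<and>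
      (\<forall>(r, U)\<in>end_targets Q. (\<sigma> ! T) r \<in> U) \<and>
      (\<forall>t\<in>{1..<T}. \<forall>(r, U)\<in>keep_targets Q. (\<sigma> ! t) r \<in> U) \<and>
      (\<forall>t\<in>{1..<T}. \<forall>a\<in>keep_negs Q. neg_ok t a) \<and>
      (\<forall>a\<in>end_negs Q. neg_ok T a) \<and>
      (\<forall>r c. g r = Some c \<longrightarrow> (\<sigma> ! T) r = c) \<and>
      (collision I \<longrightarrow>
         (\<forall>t\<le>T. \<forall>r\<in>robots W. \<forall>r'\<in>robots W. r \<noteq> r' \<longrightarrow> (\<sigma> ! t) r \<noteq> (\<sigma> ! t) r') \<and>
         (\<forall>t<T. \<forall>r\<in>robots W. \<forall>r'\<in>robots W. r \<noteq> r' \<longrightarrow>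
            \<not> ((\<sigma> ! Suc t) r = (\<sigma> ! t) r' \<and> (\<sigma> ! Suc t) r' = (\<sigma> ! t) r))) \<and>
      (partial I \<longrightarrow>
         (\<forall>r'\<in>robots W - Mv.
            (\<forall>t\<le>T. (\<sigma> ! t) r' = source Q r') \<and>
            (\<forall>t\<in>{1..T}. \<forall>r\<in>Mv. (\<sigma> ! t) r \<noteq> source Q r'))))"

definition segment_cost :: "'c wspace \<Rightarrow> 'c config list \<Rightarrow> real" where
  "segment_cost W \<sigma> = (\<Sum>(s, s')\<leftarrow>edges_of \<sigma>. \<Sum>r\<in>robots W. cost W (s r) (s' r))"

definition gmrpp_solution :: "'c wspace \<Rightarrow> impl \<Rightarrow> 'c gmrpp \<Rightarrow> nat \<Rightarrow> 'c config list \<Rightarrow> bool" where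
  "gmrpp_solution W I Q T \<sigma> \<longleftrightarrow>
     (\<exists>g Rm. intermediate_ok W I Q g \<and> (partial I \<longrightarrow> rminus_ok W Q Rm) \<and>
        is_arg_min (segment_cost W) (gmrpp_feasible W I Q g Rm T) \<sigma>)"


section \<open>Low-level paths\<close>

definition targets :: "'c wspace \<Rightarrow> (prp \<Rightarrow> nat set) \<Rightarrow> clause \<Rightarrow> (nat \<times> 'c set) set" where
  "targets W R C = {(r, region W (reg q)) | r q. q \<in> pos C \<and> r \<in> R q}"

text \<open>\<open>C\<close> is a clause chosen from the full label \<open>\<gamma>\<close> of subtask \<open>e\<close>: one that corresponds to the clause selected
  by the MILP, with the robots assigned there, or one with only negative literals if the
  relaxed label is \<open>\<top>\<close>.\<close>

definition chosen ::
  "'c wspace \<Rightarrow> ('a, 'c) problem \<Rightarrow> 'a sol \<Rightarrow> label \<Rightarrow> 'a \<times> 'a \<Rightarrow> bool \<Rightarrow>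
   clause \<Rightarrow> (prp \<Rightarrow> nat set) \<Rightarrow> bool" where
  "chosen W P s \<gamma> e a C R \<longleftrightarrow> C \<in> \<gamma> \<and>
     (if top_label P e a then pos C = {}
      else selected P s e a (pos C, False) \<and> (\<forall>q\<in>pos C. R q = essential W P s e a (pos C, False) q))"

text \<open>The first vertex in the labels of the subtasks after the \<open>n\<close>-th one that is visited by \<open>r\<close>; a
  starting vertex label comes before the edge label.\<close>

definition next_waypoint ::
  "'c wspace \<Rightarrow> ('a, 'c) problem \<Rightarrow> 'a sol \<Rightarrow> ('a \<times> 'a) list \<Rightarrow> nat \<Rightarrow> nat \<Rightarrow> 'c set \<Rightarrow> bool" where
  "next_waypoint W P s xs n r U \<longleftrightarrow>
     (let visited = (\<lambda>m a p q b. n < m \<and> m < length xs \<and> Task (xs ! m) a p q b \<in> task_verts P \<and>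
                                 inflow W P s (Task (xs ! m) a p q b) r = 1)
      in \<exists>m a p q b. visited m a p q b \<and> U = region W (reg q) \<and>
           (\<forall>m' a' p' q' b'. visited m' a' p' q' b' \<longrightarrow> m < m' \<or> m = m' \<and> (a \<longrightarrow> a')))"

text \<open>\<open>xs\<close> are the subtasks in the order of completion and \<open>es\<close> the edges of the corresponding path;
  \<open>\<sigma>s ! n\<close> is the path segment of the \<open>n\<close>-th subtask, and \<open>Cs ! n\<close>, \<open>Rs ! n\<close> are the clause of its edge label
  that is satisfied at the end of the segment and the robots that satisfy it. In the suffix, \<open>fin\<close>
  prescribes the latter for the last subtask.\<close>

definition low_level ::
  "'c wspace \<Rightarrow> impl \<Rightarrow> (nat \<Rightarrow> nat set) \<Rightarrow> ('a, 'c) problem \<Rightarrow> 'a sol \<Rightarrow>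
   (clause \<times> (prp \<Rightarrow> nat set)) option \<Rightarrow> ('a \<times> 'a) list \<Rightarrow> ('a \<times> 'a) list \<Rightarrow>
   'c config list list \<Rightarrow> clause list \<Rightarrow> (prp \<Rightarrow> nat set) list \<Rightarrow> bool" where
  "low_level W I \<rho> P s fin xs es \<sigma>s Cs Rs \<longleftrightarrow>
     length xs = length es \<and> length \<sigma>s = length es \<and> length Cs = length es \<and> length Rs = length es \<and>
     (\<forall>n<length es.
        let e = xs ! n; u = fst (es ! n); v = snd (es ! n);
            s0 = (if n = 0 then start P else last (\<sigma>s ! (n - 1)));
            C = Cs ! n; R = Rs ! n
        in
        if n = 0 \<and> te s e = 0
        then \<sigma>s ! n = [s0] \<and> C \<in> full_lab P u v \<and> sat_clause W \<rho> s0 R C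
        else
          (case fin of
             None \<Rightarrow> chosen W P s (full_lab P u v) e True C R
           | Some (Cf, Rf) \<Rightarrow>
               if n = length es - 1 then C = Cf \<and> R = Rf
               else chosen W P s (full_lab P u v) e True C R) \<and>
          (\<exists>C1 R1 T.
             chosen W P s (full_lab P u u) e False C1 R1 \<and>
             (top_label P e False \<longrightarrow>
                (if n = 0 then sat_clause W \<rho> s0 R1 C1 else C1 \<subseteq> Cs ! (n - 1))) \<and>
             1 \<le> T \<and>
             gmrpp_solution W I
               \<lparr>source = s0, keep_targets = targets W R1 C1, end_targets = targets W R C,
                keep_negs = neg C1, end_negs = neg C, waypoint = next_waypoint W P s xs n\<rparr>
               T (\<sigma>s ! n)))"

definition concat_segments :: "'c config list list \<Rightarrow> 'c config list" where
  "concat_segments \<sigma>s = hd \<sigma>s @ concat (map tl (tl \<sigma>s))"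


section \<open>The synthesis method\<close>

text \<open>Posets, MILP and low-level path on the sub-automaton \<open>graph P\<close>, from \<open>v0\<close> to \<open>va\<close>. \<open>L\<close> is the
  set of further MILP constraints (last subtask; connectors fixed before), and \<open>\<rho>\<close> must agree with
  the robots that the MILP assigns to the connectors it uses.\<close>

definition synthesis ::
  "'c wspace \<Rightarrow> impl \<Rightarrow> real \<Rightarrow> nat \<Rightarrow> (nat \<Rightarrow> nat set) \<Rightarrow> 'a \<Rightarrow> 'a \<Rightarrow> ('a, 'c) problem \<Rightarrow>
   ('a sol \<Rightarrow> bool) \<Rightarrow> (clause \<times> (prp \<Rightarrow> nat set)) option \<Rightarrow>
   'a sol \<Rightarrow> 'a list \<Rightarrow> 'c config list list \<Rightarrow> clause list \<Rightarrow> (prp \<Rightarrow> nat set) list \<Rightarrow> bool" where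
  "synthesis W I \<alpha> M \<rho> v0 va P L fin s us \<sigma>s Cs Rs \<longleftrightarrow>
     (\<exists>us0. simple_path (graph P) v0 va us0 \<and> tasks P = set (edges_of us0)) \<and>
     admissible_poset (tasks P) (path_orders (full_lab P) (graph P) v0 va (tasks P)) (prec P) \<and>
     is_arg_min (objective W \<alpha> P) (\<lambda>s'. milp_base W M P s' \<and> L s') s \<and>
     (\<forall>(\<chi>, R)\<in>conn_used W P s. \<rho> \<chi> = R) \<and>
     simple_path (graph P) v0 va us \<and>
     (\<exists>xs. distinct xs \<and> set xs = tasks P \<and> sorted_wrt (\<lambda>e e'. te s e < te s e') xs \<and>
        list_all2 (same_subtask (full_lab P) (graph P) v0 va) xs (edges_of us) \<and>
        low_level W I \<rho> P s fin xs (edges_of us) \<sigma>s Cs Rs)"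

definition prefix_synthesis ::
  "'c wspace \<Rightarrow> impl \<Rightarrow> real \<Rightarrow> nat \<Rightarrow> 'a nba \<Rightarrow> (nat \<Rightarrow> nat set) \<Rightarrow> 'a \<Rightarrow>
   'c config list \<Rightarrow> 'a \<Rightarrow> clause \<Rightarrow> (prp \<Rightarrow> nat set) \<Rightarrow> (nat \<times> nat set) set \<Rightarrow> bool" where
  "prefix_synthesis W I \<alpha> M G \<rho> va pre vp Cp Rp used \<longleftrightarrow>
     (\<exists>v0\<in>inits G. \<exists>P s us \<sigma>s Cs Rs el pl.
        va \<in> accs G \<and>
        (\<exists>us. simple_path (pruned_edges G) v0 va us) \<and>
        ((va, va) \<in> pruned_edges G \<or> (\<exists>us. simple_path (pruned_edges G) va va us)) \<and>
        full_lab P = lab G \<and> start P = init_conf W \<and> extra P = None \<and>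
        graph P = sub_minus (lab G) (sat_label W \<rho> (init_conf W)) v0 va (prefix_graph G v0 va) \<and>
        synthesis W I \<alpha> M \<rho> v0 va P (prefix_last_ok P el pl) None s us \<sigma>s Cs Rs \<and>
        pre = concat_segments \<sigma>s \<and> vp = last (butlast us) \<and> Cp = last Cs \<and> Rp = last Rs \<and>
        used = conn_used W P s)"

text \<open>The suffix from \<open>sp\<close>. \<open>Rp\<close> are the robots that satisfy the literals of \<open>Cp\<close> at \<open>sp\<close>, enumerated by
  \<open>f\<close> for the extra clause.\<close>

definition suffix_synthesis ::
  "'c wspace \<Rightarrow> impl \<Rightarrow> real \<Rightarrow> nat \<Rightarrow> 'a nba \<Rightarrow> (nat \<Rightarrow> nat set) \<Rightarrow> 'a \<Rightarrow>
   'c config \<Rightarrow> 'a \<Rightarrow> clause \<Rightarrow> (prp \<Rightarrow> nat set) \<Rightarrow> (nat \<times> nat set) set \<Rightarrow> 'c config list \<Rightarrow> bool" where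
  "suffix_synthesis W I \<alpha> M G \<rho> va sp vp Cp Rp used suf \<longleftrightarrow>
     (if (va, va) \<in> pruned_edges G \<and> sat_label W \<rho> sp (lab G va va) then suf = [sp]
      else \<exists>P f s us \<sigma>s Cs Rs T \<sigma>.
        (\<forall>q\<in>pos Cp. bij_betw (f q) {..<num q} (Rp q)) \<and>
        full_lab P = lab G \<and> start P = sp \<and> extra P = Some (pos Cp, f) \<and>
        graph P = sub_minus (lab G) (sat_label W \<rho> sp) va va (suffix_graph G va (lab G vp va)) \<and>
        synthesis W I \<alpha> M \<rho> va va P
          (\<lambda>s'. suffix_last_ok W M P s' \<and>
             (\<forall>(\<chi>, R)\<in>used. \<forall>(\<chi>', R')\<in>conn_used W P s'. \<chi> = \<chi>' \<longrightarrow> R = R'))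
          (Some (Cp, Rp)) s us \<sigma>s Cs Rs \<and>
        gmrpp_solution W I
          \<lparr>source = last (last \<sigma>s), keep_targets = targets W Rp Cp,
           end_targets = {(r, {sp r}) | r. r \<in> robots W},
           keep_negs = neg Cp, end_negs = neg Cp, waypoint = (\<lambda>_ _. False)\<rparr> T \<sigma> \<and>
        suf = concat_segments (\<sigma>s @ [\<sigma>]))"

text \<open>\<open>returned W I \<alpha> M A pre suf\<close>: the method, started with the automaton \<open>A\<close>, weight \<open>\<alpha>\<close> and
  big-M constant \<open>M\<close> and using implementation \<open>I\<close> of the GMRPP, may return the path with prefix \<open>pre\<close> and loop \<open>suf\<close>.
  \<open>\<rho>\<close> collects the robots realising the connectors in this run; the tests of labels at the
  initial configurations of prefix and suffix refer to it.\<close>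

definition returned ::
  "'c wspace \<Rightarrow> impl \<Rightarrow> real \<Rightarrow> nat \<Rightarrow> 'v nba \<Rightarrow> 'c config list \<Rightarrow> 'c config list \<Rightarrow> bool" where
  "returned W I \<alpha> M A pre suf \<longleftrightarrow>
     (\<exists>\<rho> va vp Cp Rp used. let G = prep W (collision I) A in
        prefix_synthesis W I \<alpha> M G \<rho> va pre vp Cp Rp used \<and>
        suffix_synthesis W I \<alpha> M G \<rho> va (last pre) vp Cp Rp used suf)"

end

theory Submission
  imports Defs
begin

text \<open>A run of the automaton is built along the returned path. If \<open>(u, v)\<close> is the edge of the current
  subtask, a GMRPP solution satisfies a clause of the label of the self-loop at \<open>u\<close> strictly between
  its end points and a clause of the label of \<open>(u, v)\<close> at its end: the robots of the MILP reach their
  targets, and each implementation of the GMRPP keeps the negative literals true, for partial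
  execution because robots that do not move are counted at time 0. That literals of one clause
  are realised by the right number of distinct robots follows from the flow constraints: a robot
  follows one path in the routing graph, along which a potential increases strictly, so that
  it visits each label of each subtask at most once. Finally, undoing the absorption of literals turns the
  satisfied clauses into clauses of the original automaton, for the trace and for the connector trace
  alike.\<close>

section \<open>Clauses of the pre-processed automaton\<close>

text \<open>The two halves of \<open>satisfies\<close> concern different words: one counts robots,
  the other fixes teams. A single run of vertices serves both because each transition is justified
  by \<open>sat_label\<close>, which refers to configurations and robots instead of words. A
  statement about words of atoms would be too weak: absorption leaves only the residue of a literal,
  and the residue gives back the original number only if the robots counted are disjoint. So the
  invariant carries the robot assignment, with one \<open>\<rho>\<close> for the entire path. The
  other difficulty lies at the end points of segments. A transition reads the configuration present
  when it is taken, so within the prefix or the loop a configuration shared by two consecutive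
  segments is read once. The start configuration is read either by a self-loop at the start vertex
  or by the first edge; if the self-loop is missing, the MILP sets the first completion time to 0,
  which enforces the second alternative.\<close>

lemma pos_neg_simps [simp]:
  "pos (norm_neg C) = pos C" "neg (norm_neg C) = unconn ` neg C"
  "neg (pp_pos C) = neg C" "pos (pp_neg C) = pos C"
  by (auto simp: pos_def neg_def norm_neg_def pp_pos_def pp_neg_def)

lemma unconn_simps [simp]:
  "num (unconn a) = num a" "kind (unconn a) = kind a" "reg (unconn a) = reg a"
  "conn (unconn a) = 0" "unconn (unconn a) = unconn a"
  by (simp_all add: unconn_def)

lemma present_unconn [simp]: "present W s (unconn a) = present W s a"
  by (simp add: present_def)

lemma finite_team: "workspace W \<Longrightarrow> j < ntyp W \<Longrightarrow> finite (team W j)"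
  unfolding workspace_def by (metis UN_I finite_lessThan finite_subset lessThan_iff subsetI)

lemma team_robots: "workspace W \<Longrightarrow> j < ntyp W \<Longrightarrow> team W j \<subseteq> robots W"
  unfolding workspace_def by blast

text \<open>A type index outside the range may have an arbitrary, even infinite, team, for which
  \<open>card\<close> says nothing; bounding the types keeps all cardinalities meaningful.\<close>

definition typed :: "'c wspace \<Rightarrow> clause \<Rightarrow> bool" where
  "typed W C \<longleftrightarrow> finite C \<and> (\<forall>a\<in>pos C \<union> neg C. kind a < ntyp W)"

lemma finite_pos_neg:
  assumes "finite C"
  shows "finite (pos C)" "finite (neg C)"
proof -
  have "pos C \<subseteq> (\<lambda>l. case l of Pos a \<Rightarrow> a | Neg a \<Rightarrow> a) ` C"
    and "neg C \<subseteq> (\<lambda>l. case l of Pos a \<Rightarrow> a | Neg a \<Rightarrow> a) ` C"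
    by (force simp: pos_def neg_def image_iff)+
  then show "finite (pos C)" "finite (neg C)"
    using assms by (meson finite_imageI finite_subset)+
qed

lemma card_le_present:
  assumes "workspace W" "kind a < ntyp W" "U \<subseteq> team W (kind a)" "\<forall>r\<in>U. s r \<in> region W (reg a)"
  shows "card U \<le> present W s a"
  unfolding present_def
  by (rule card_mono) (use assms finite_team[OF assms(1,2)] in auto)

text \<open>The part of \<open>sat_clause\<close> that does not mention the configuration. It comes
  from the MILP once and for all, whereas the GMRPP supplies the rest at each single time.\<close>

definition assigned :: "'c wspace \<Rightarrow> (nat \<Rightarrow> nat set) \<Rightarrow> (prp \<Rightarrow> nat set) \<Rightarrow> clause \<Rightarrow> bool" where
  "assigned W \<rho> R C \<longleftrightarrow>
     (\<forall>a\<in>pos C. R a \<subseteq> team W (kind a) \<and> card (R a) = num a \<and> (conn a \<noteq> 0 \<longrightarrow> R a = \<rho> (conn a))) \<and>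
     (\<forall>a\<in>pos C. \<forall>a'\<in>pos C. a \<noteq> a' \<and> kind a = kind a' \<and> reg a = reg a' \<longrightarrow> R a \<inter> R a' = {})"

lemma sat_clause_iff:
  "sat_clause W \<rho> s R C \<longleftrightarrow>
     assigned W \<rho> R C \<and> (\<forall>a\<in>pos C. \<forall>r\<in>R a. s r \<in> region W (reg a)) \<and>
     (\<forall>a\<in>neg C. present W s a < num a)"
  unfolding sat_clause_def assigned_def by (intro iffI conjI ballI impI; blast)

lemma pos_neg_mono: "C' \<subseteq> C \<Longrightarrow> pos C' \<subseteq> pos C \<and> neg C' \<subseteq> neg C"
  by (auto simp: pos_def neg_def)

lemma sat_clause_mono:
  assumes "sat_clause W \<rho> s R C" "C' \<subseteq> C"
  shows "sat_clause W \<rho> s R C'"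
proof -
  have *: "(\<forall>a\<in>A'. Q a) \<and> (\<forall>a\<in>A'. \<forall>b\<in>A'. Q' a b) \<and> (\<forall>a\<in>B'. Q'' a)"
    if "(\<forall>a\<in>A. Q a) \<and> (\<forall>a\<in>A. \<forall>b\<in>A. Q' a b) \<and> (\<forall>a\<in>B. Q'' a)" "A' \<subseteq> A" "B' \<subseteq> B"
    for A A' B B' :: "prp set" and Q Q' Q''
    using that by blast
  show ?thesis
    using pos_neg_mono[OF assms(2)] assms(1) unfolding sat_clause_def
    by (elim conjE) (rule *[of "pos C" _ _ "neg C"]; (intro conjI)?; assumption)
qed

lemma sat_label_mono:
  "sat_clause W \<rho> s R C \<Longrightarrow> C' \<subseteq> C \<Longrightarrow> C' \<in> \<gamma> \<Longrightarrow> sat_label W \<rho> s \<gamma>"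
  unfolding sat_label_def using sat_clause_mono by blast

text \<open>Literals of the pre-processed clause with the same type and region count disjoint sets of
  robots, so their numbers add up to at least that of the absorbed literal.\<close>

lemma absorbed_pos:
  assumes W: "workspace W" and ty: "typed W C"
    and sat: "sat_clause W \<rho> s R (pp_neg (pp_pos (norm_neg C)))" (is "sat_clause W \<rho> s R ?C")
    and a: "a \<in> pos C"
  shows "num a \<le> present W s a"
proof -
  define S where "S = {a' \<in> pos C. conn a' = 0 \<and> kind a' = kind a \<and> reg a' = reg a}"
  define D where "D = {a' \<in> pos C. conn a' \<noteq> 0 \<and> kind a' = kind a \<and> reg a' = reg a}"
  have ka: "kind a < ntyp W" using ty a by (auto simp: typed_def)
  have finC: "finite (pos C)" using ty finite_pos_neg by (auto simp: typed_def)
  have finS: "finite S" and finD: "finite D" using finC by (auto simp: S_def D_def)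
  have conn_pos: "a' \<in> pos ?C" if "a' \<in> pos C" "conn a' \<noteq> 0" for a'
    using that by (auto simp: pos_def pp_neg_def pp_pos_def norm_neg_def)
  have R: "R a' \<subseteq> team W (kind a')" "card (R a') = num a'" "\<forall>r\<in>R a'. s r \<in> region W (reg a')"
    if "a' \<in> pos ?C" for a'
    using sat that by (auto simp: sat_clause_def simp del: pos_neg_simps)
  have disj: "R b \<inter> R b' = {}"
    if "b \<in> pos ?C" "b' \<in> pos ?C" "b \<noteq> b'" "kind b = kind b'" "reg b = reg b'" for b b'
    using sat that unfolding sat_clause_def by blast
  have finR: "finite (R a')" if "a' \<in> pos ?C" "kind a' = kind a" for a'
    using R(1)[OF that(1)] finite_team[OF W ka] that(2) finite_subset by metis
  have Dsub: "d \<in> pos ?C" "kind d = kind a" "reg d = reg a" if "d \<in> D" for d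
    using that conn_pos by (auto simp: D_def)
  let ?U = "\<Union>d\<in>D. R d"
  have cU: "card ?U = (\<Sum>d\<in>D. num d)"
  proof -
    have "card ?U = (\<Sum>d\<in>D. card (R d))"
    proof (rule card_UN_disjoint[OF finD])
      show "\<forall>d\<in>D. finite (R d)" using finR Dsub by blast
      show "\<forall>d\<in>D. \<forall>d'\<in>D. d \<noteq> d' \<longrightarrow> R d \<inter> R d' = {}"
        by (metis Dsub disj)
    qed
    also have "\<dots> = (\<Sum>d\<in>D. num d)" by (rule sum.cong) (use R Dsub in auto)
    finally show ?thesis .
  qed
  have cs: "conn_sum (norm_neg C) b = card ?U" if "kind b = kind a" "reg b = reg a" for b
    unfolding cU unfolding conn_sum_def D_def using that by simp
  have U_team: "?U \<subseteq> team W (kind a)" "\<forall>r\<in>?U. s r \<in> region W (reg a)"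
    using R(1,3)[OF Dsub(1)] Dsub(2,3) by force+
  have finU: "finite ?U" using finD finR Dsub by blast
  show ?thesis
  proof (cases "conn a = 0")
    \<comment> \<open>A literal with a connector survives pre-processing unchanged, so its own team
      suffices.\<close>
    case False
    show ?thesis
      using card_le_present[OF W ka R(1)[OF conn_pos[OF a False]] R(3)[OF conn_pos[OF a False]]]
        R(2)[OF conn_pos[OF a False]] by simp
  next
    case True
    then have "S \<noteq> {}" using a by (auto simp: S_def)
    then have "Max (num ` S) \<in> num ` S" using finS by simp
    then obtain m where "m \<in> S" "num m = Max (num ` S)" by auto
    then have m: "m \<in> S" "\<forall>a'\<in>S. num a' \<le> num m" using finS by auto
    have am: "num a \<le> num m" using m a True by (auto simp: S_def)
    show ?thesis
    \<comment> \<open>\<open>m\<close> is the largest of the literals without connector. Either the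
      connected teams in \<open>?U\<close> already reach its number and no residue is left, or the
      residue \<open>?b\<close> counts the missing robots, all of them outside
      \<open>?U\<close>.\<close>
    proof (cases "card ?U < num m")
      case False
      then show ?thesis using card_le_present[OF W ka U_team] am by linarith
    next
      case True
      let ?b = "Prp (num m - card ?U) (kind a) (reg a) 0"
      have mm: "m \<in> pos C" "conn m = 0" "kind m = kind a" "reg m = reg a" using m by (auto simp: S_def)
      have "Pos ?b \<in> pp_pos (norm_neg C)"
        unfolding pp_pos_def using mm m(2) True cs[OF mm(3,4)]
        by (intro UnI2) (auto simp: S_def intro!: exI[of _ m])
      then have b: "?b \<in> pos ?C" by (simp add: pos_def[of "pp_pos _"])
      have "R ?b \<inter> R d = {}" if "d \<in> D" for d
        by (rule disj[OF b Dsub(1)[OF that]]) (use that in \<open>auto simp: D_def\<close>)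
      then have "R ?b \<inter> ?U = {}" by blast
      then have "card (R ?b \<union> ?U) = num m"
        using card_Un_disjoint[OF finR[OF b] finU] R(2)[OF b] True by simp
      moreover have "card (R ?b \<union> ?U) \<le> present W s a"
        by (rule card_le_present[OF W ka]) (use U_team R[OF b] in auto)
      ultimately show ?thesis using am by linarith
    qed
  qed
qed

text \<open>Undoes pre-processing. Among negative literals on the same type and region the one with
  the least number survives and implies the others; positive ones are covered by
  \<open>absorbed_pos\<close>. For the second word, literals with connectors need exactly the team
  \<open>\<rho>\<close> prescribes, and they are never absorbed.\<close>

lemma sat_pp_clause:
  assumes W: "workspace W" and ty: "typed W C"
    and sat: "sat_clause W \<rho> s R (pp_neg (pp_pos (norm_neg C)))" (is "sat_clause W \<rho> s R ?C")
  shows "models {a. num a \<le> present W s a} C" and "models {a. atom_true W \<rho> s a} C"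
proof -
  have n: "present W s a < num a" if "a \<in> neg C" for a
  proof -
    define S where "S = {b \<in> unconn ` neg C. kind b = kind a \<and> reg b = reg a}"
    have "unconn a \<in> S" using that by (auto simp: S_def)
    then obtain m where m: "m \<in> S" "\<forall>b\<in>S. num m \<le> num b"
      using ex_has_least_nat[of "\<lambda>x. x \<in> S" "unconn a" num] by blast
    have mC: "m \<in> unconn ` neg C" using m by (auto simp: S_def)
    have "\<not> (\<exists>b\<in>unconn ` neg C. kind b = kind m \<and> reg b = reg m \<and> num b < num m)"
      using m by (fastforce simp: S_def)
    with mC have "Neg m \<in> ?C"
      unfolding pp_neg_def pos_neg_simps by (intro UnI2 imageI) simp
    then have "m \<in> neg ?C" by (simp add: neg_def)
    then have "present W s m < num m" using sat unfolding sat_clause_def by blast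
    moreover have "present W s m = present W s a" using m by (auto simp: S_def present_def)
    moreover have "num m \<le> num a" using m(2) \<open>unconn a \<in> S\<close> by force
    ultimately show ?thesis by linarith
  qed
  note p = absorbed_pos[OF W ty sat]
  show "models {a. num a \<le> present W s a} C"
    using n p by (auto simp: models_def not_le)
  have "atom_true W \<rho> s a" if "a \<in> pos C" for a
  proof (cases "conn a = 0")
    case True
    then show ?thesis using p[OF that] by (simp add: atom_true_def)
  next
    case False
    then have "a \<in> pos ?C" using that by (auto simp: pos_def pp_neg_def pp_pos_def norm_neg_def)
    then show ?thesis using sat False unfolding sat_clause_def atom_true_def by force
  qed
  moreover have "\<not> atom_true W \<rho> s (unconn a)" if "a \<in> neg C" for a
    using n[OF that] by (simp add: atom_true_def)
  ultimately show "models {a. atom_true W \<rho> s a} C"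
    unfolding models_def by blast
qed

lemma typed_pp_clause:
  assumes "typed W C"
  shows "typed W (pp_neg (pp_pos (norm_neg C)))"
proof -
  have fin: "finite (pos C)" "finite (neg C)" using assms finite_pos_neg by (auto simp: typed_def)
  let ?C = "norm_neg C"
  have "pp_pos ?C \<subseteq> Neg ` neg ?C \<union> Pos ` pos ?C \<union>
      (\<lambda>a. Pos (Prp (num a - conn_sum ?C a) (kind a) (reg a) 0)) ` pos ?C"
    by (auto simp: pp_pos_def)
  then have "finite (pp_pos ?C)" by (rule finite_subset) (use fin in auto)
  then have "finite (pp_neg (pp_pos ?C))"
    using finite_pos_neg(1)[of "pp_pos ?C"] fin by (auto simp: pp_neg_def)
  moreover have "kind a < ntyp W" if "a \<in> pos (pp_pos ?C)" for a
    using that assms unfolding pos_def[of "pp_pos _"] by (auto simp: pp_pos_def typed_def)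
  moreover have "kind a < ntyp W" if "a \<in> neg (pp_neg (pp_pos ?C))" for a
    using that assms unfolding neg_def[of "pp_neg _"] by (auto simp: pp_neg_def typed_def)
  ultimately show ?thesis by (auto simp: typed_def)
qed

lemma typed_label:
  assumes "workspace W" "formula_over W f" "nba_for A f" "C \<in> lab A u v"
  shows "typed W C"
proof -
  have "finite C" "pos C \<union> neg C \<subseteq> atoms f \<union> unconn ` atoms f"
    using assms(3,4) unfolding nba_for_def by blast+
  then show ?thesis
    using assms(2) unfolding formula_over_def typed_def by auto
qed

section \<open>Typed labels, and runs of the original automaton\<close>

definition typed_labels :: "'c wspace \<Rightarrow> ('a \<Rightarrow> 'a \<Rightarrow> label) \<Rightarrow> bool" where
  "typed_labels W \<gamma> \<longleftrightarrow> (\<forall>u v. finite (\<gamma> u v) \<and> (\<forall>C\<in>\<gamma> u v. typed W C))"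

lemma typed_labels_prep:
  assumes "workspace W" "formula_over W f" "nba_for A f"
  shows "typed_labels W (lab (prep W ca A))"
proof -
  have "finite (lab A u v)" for u v using assms(3) by (auto simp: nba_for_def)
  then have "finite (pp_label W ca (lab A u v))" for u v
    by (simp add: pp_label_def)
  moreover have "typed W C" if "C \<in> pp_label W ca (lab A u v)" for u v C
    using that typed_pp_clause[OF typed_label[OF assms]] by (auto simp: pp_label_def)
  ultimately show ?thesis
    unfolding typed_labels_def by (auto simp: prep_def)
qed

text \<open>Membership in \<open>trace\<close> ignores the connector, so neither polarity nor
  \<open>drop_conn\<close> makes a difference. Hence the automaton for the formula with connectors
  also decides the plain half of \<open>satisfies\<close>.\<close>

lemma holds_trace_drop:
  "holds b (trace W \<tau>) t (drop_conn f) = holds b (trace W \<tau>) t f"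
  by (induction f arbitrary: b t) (auto simp: trace_def)

lemma prep_accs_fst: "v \<in> accs (prep W ca A) \<Longrightarrow> fst v \<in> accs A"
  by (auto simp: prep_def)

lemma prep_inits_fst: "v \<in> inits (prep W ca A) \<Longrightarrow> fst v \<in> inits A"
  by (auto simp: prep_def)

text \<open>At each time one clause of \<open>A\<close> models the letters of both words, so the
  same vertex sequence, with the copy flags of \<open>prep\<close> dropped, accepts both.\<close>

lemma satisfies_if_run:
  assumes W: "workspace W" "formula_over W f" "nba_for A f"
    and run: "v 0 \<in> inits (prep W ca A)"
      "\<And>t. sat_label W \<rho> (\<tau> t) (lab (prep W ca A) (v t) (v (Suc t)))"
    and acc: "va \<in> accs (prep W ca A)" "va \<in> limit v"
  shows "satisfies W \<tau> f"
proof -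
  let ?v = "\<lambda>t. fst (v t)"
  have ex: "\<exists>C\<in>lab A (?v t) (?v (Suc t)).
      models {a. num a \<le> present W (\<tau> t) a} C \<and> models {a. atom_true W \<rho> (\<tau> t) a} C" for t
  proof -
    obtain C R where C: "C \<in> lab (prep W ca A) (v t) (v (Suc t))" "sat_clause W \<rho> (\<tau> t) R C"
      using run(2)[of t] unfolding sat_label_def by blast
    then obtain C0 where "C0 \<in> lab A (?v t) (?v (Suc t))" "C = pp_neg (pp_pos (norm_neg C0))"
      by (auto simp: prep_def pp_label_def split: prod.splits if_splits)
    then show ?thesis using sat_pp_clause[OF W(1) typed_label[OF W]] C(2) by blast
  qed
  have lim: "fst va \<in> limit ?v"
    using acc(2) unfolding limit_iff_frequent by (rule INFM_mono) auto
  have "accepts A (trace W \<tau>)" "accepts A (conn_trace W \<rho> \<tau>)"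
    unfolding accepts_def trace_def conn_trace_def
    using ex lim prep_accs_fst[OF acc(1)] prep_inits_fst[OF run(1)]
    by (intro exI[of _ ?v]; blast)+
  then show ?thesis
    using W(3) unfolding satisfies_def holds_trace_drop nba_for_def by blast
qed

section \<open>Routes of the robots in a MILP solution\<close>

lemma single_sum:
  fixes f :: "'b \<Rightarrow> nat"
  assumes "finite A" "sum f A \<le> 1" "x \<in> A" "f x \<noteq> 0"
  shows "f x = 1" and "\<And>y. y \<in> A \<Longrightarrow> y \<noteq> x \<Longrightarrow> f y = 0"
proof -
  have "sum f A = f x + sum f (A - {x})" using assms by (simp add: sum.remove)
  then show "f x = 1" using assms by linarith
  then have "sum f (A - {x}) = 0" using \<open>sum f A = f x + sum f (A - {x})\<close> assms by linarith
  then show "\<And>y. y \<in> A \<Longrightarrow> y \<noteq> x \<Longrightarrow> f y = 0" using assms(1) by simp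
qed

text \<open>What prefix and suffix problems share. Sums over infinite sets are 0, so finiteness is
  what gives the constraints their content. \<open>rob_robots\<close> matters because the extra
  clause of the suffix names robots through an arbitrary function, while the flow constraints range
  over actual robots.\<close>

locale milp_solution =
  fixes W :: "'c wspace" and M :: nat and P :: "('a, 'c) problem" and s :: "'a sol"
  assumes ws: "workspace W"
    and finite_tasks: "finite (tasks P)"
    and order: "strict_order_on (tasks P) (prec P)"
    and finite_clauses: "\<And>e a. finite (clauses P e a)"
    and finite_clause: "\<And>e a p. p \<in> clauses P e a \<Longrightarrow> finite (fst p)"
    and rob_robots: "\<And>v. v \<in> task_verts P \<Longrightarrow> rob W P v \<subseteq> robots W"
    and milp: "milp_base W M P s"
begin

lemma constraints:
  "binary_vars W P s" "flow_ok W M P s" "travel_ok W M P s" "label_ok W P s"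
  "completion_ok W M P s" "order_ok M P s"
  using milp unfolding milp_base_def by blast+

lemma task_vert_iff:
  "Task e a p q b \<in> task_verts P \<longleftrightarrow>
     e \<in> tasks P \<and> proper_label P e a \<and> p \<in> clauses P e a \<and> q \<in> fst p \<and> b < num q"
  unfolding task_verts_def clause_verts_def lit_verts_def by blast

lemma clause_vert_iff: "Task e a p q b \<in> clause_verts e a p \<longleftrightarrow> q \<in> fst p \<and> b < num q"
  by (auto simp: clause_verts_def lit_verts_def)

lemma clause_vertE:
  assumes "v \<in> clause_verts e a p"
  obtains q b where "v = Task e a p q b" "q \<in> fst p" "b < num q"
  using assms by (auto simp: clause_verts_def lit_verts_def)

lemma task_vertE:
  assumes "v \<in> task_verts P"
  obtains e a p q b where "v = Task e a p q b" "v \<in> clause_verts e a p"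
    "e \<in> tasks P" "proper_label P e a" "p \<in> clauses P e a"
  using assms by (auto simp: task_verts_def)(metis clause_vertE)

lemma finite_clause_verts: "p \<in> clauses P e a \<Longrightarrow> finite (clause_verts e a p)"
  using finite_clause by (auto simp: clause_verts_def lit_verts_def)

lemma card_clause_verts:
  assumes "p \<in> clauses P e a"
  shows "card (clause_verts e a p) = (\<Sum>q\<in>fst p. num q)"
proof -
  have "card (clause_verts e a p) = (\<Sum>q\<in>fst p. card (lit_verts e a p q))"
    unfolding clause_verts_def
    by (rule card_UN_disjoint) (use finite_clause[OF assms] in \<open>auto simp: lit_verts_def\<close>)
  also have "\<dots> = (\<Sum>q\<in>fst p. num q)"
    unfolding lit_verts_def by (intro sum.cong) (auto simp: card_image inj_on_def)
  finally show ?thesis .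
qed

lemma finite_task_verts: "finite (task_verts P)"
  unfolding task_verts_def using finite_tasks finite_clauses finite_clause_verts
  by (intro finite_UN_I) auto

lemma finite_rverts: "finite (rverts W P)"
  unfolding rverts_def using finite_task_verts by simp

lemma finite_preds: "finite {u. (u, v) \<in> redges W P}"
  and finite_succs: "finite {w. (v, w) \<in> redges W P}"
  by (rule finite_subset[OF _ finite_rverts], auto simp: redges_def)+

lemma finite_rob: "v \<in> task_verts P \<Longrightarrow> finite (rob W P v)"
  using rob_robots finite_subset by blast

section \<open>The flow of a single robot and the times along it\<close>

definition hop :: "nat \<Rightarrow> ('a rvert \<times> 'a rvert) set" where
  "hop r = {(u, v). xvar s u v r = 1}"

lemma hopD:
  assumes "(u, v) \<in> hop r"
  shows "(u, v) \<in> redges W P" "r \<in> rob W P v" "v \<in> task_verts P" "r \<in> robots W"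
    "inflow W P s v r \<noteq> 0" "outflow W P s u r \<noteq> 0"
proof -
  have x: "xvar s u v r = 1" using assms by (simp add: hop_def)
  then have "xvar s u v r \<noteq> 0" by simp
  then show uv: "(u, v) \<in> redges W P" "r \<in> rob W P v"
    using constraints(1) unfolding binary_vars_def by blast+
  show "v \<in> task_verts P" using uv(1) by (auto simp: redges_def rverts_def)
  then show "r \<in> robots W" using rob_robots uv(2) by blast
  show "inflow W P s v r \<noteq> 0"
    unfolding inflow_def using uv(1) x finite_preds[of v] by (subst sum_eq_0_iff) auto
  show "outflow W P s u r \<noteq> 0"
    unfolding outflow_def using uv(1) x finite_succs[of u] by (subst sum_eq_0_iff) auto
qed

lemma inflow_hop:
  assumes "inflow W P s v r \<noteq> 0"
  obtains u where "(u, v) \<in> hop r"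
proof -
  from assms obtain u where "xvar s u v r \<noteq> 0"
    unfolding inflow_def by (meson sum.neutral)
  moreover have "xvar s u v r \<le> 1" using constraints(1) unfolding binary_vars_def by blast
  ultimately have "(u, v) \<in> hop r" by (simp add: hop_def)
  then show thesis by (rule that)
qed

lemma inflow_vert:
  "inflow W P s v r \<noteq> 0 \<Longrightarrow> v \<in> task_verts P \<and> r \<in> rob W P v \<and> r \<in> robots W"
  using inflow_hop hopD by metis

lemma inflow_unique:
  assumes "inflow W P s v r \<noteq> 0"
  shows "inflow W P s v r = 1" and "\<And>r'. r' \<noteq> r \<Longrightarrow> inflow W P s v r' = 0"
proof -
  have v: "v \<in> task_verts P" "r \<in> rob W P v" using inflow_vert[OF assms] by auto
  have "(\<Sum>r\<in>rob W P v. inflow W P s v r) \<le> 1"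
    using constraints(2) v unfolding flow_ok_def visits_def by blast
  note * = single_sum[OF finite_rob[OF v(1)] this v(2) assms]
  show "inflow W P s v r = 1" by (rule *(1))
  show "inflow W P s v r' = 0" if "r' \<noteq> r" for r'
    using *(2)[OF _ that] inflow_vert[of v r'] by blast
qed

lemma no_inflow_times:
  assumes "v \<in> task_verts P" "r \<in> robots W" "inflow W P s v r = 0"
  shows "tminus s v r = 0" "tplus s v r = 0"
proof -
  have "tminus s v r \<le> M * inflow W P s v r" "tplus s v r \<le> M * inflow W P s v r"
    using assms(1,2) constraints(2) unfolding flow_ok_def by blast+
  then show "tminus s v r = 0" "tplus s v r = 0" using assms(3) by simp_all
qed

text \<open>The big-M bounds force time 0 for robots that do not visit \<open>v\<close>, so the sum
  over robots is the time of the only visitor.\<close>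

lemma T_eq:
  assumes "inflow W P s v r \<noteq> 0"
  shows "Tminus W P s v = tminus s v r" "Tplus W P s v = tplus s v r"
proof -
  have v: "v \<in> task_verts P" "r \<in> rob W P v" using inflow_vert[OF assms] by auto
  have z: "tminus s v r' = 0 \<and> tplus s v r' = 0" if "r' \<in> rob W P v - {r}" for r'
    using no_inflow_times[OF v(1)] inflow_unique(2)[OF assms] that rob_robots[OF v(1)] by blast
  show "Tminus W P s v = tminus s v r" "Tplus W P s v = tplus s v r"
    unfolding Tminus_def Tplus_def using z v(2) finite_rob[OF v(1)] by (simp_all add: sum.remove)
qed

lemma label_constraints:
  assumes "e \<in> tasks P" "proper_label P e a"
  shows "(\<Sum>p\<in>clauses P e a. bcl s e a p) = 1"
    and "p \<in> clauses P e a \<Longrightarrow>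
      (\<Sum>v\<in>clause_verts e a p. visits W P s v) = bcl s e a p * (\<Sum>q\<in>fst p. num q)"
  using constraints(4) assms unfolding label_ok_def by blast+

lemma visits_le: "v \<in> task_verts P \<Longrightarrow> visits W P s v \<le> 1"
  using constraints(2) unfolding flow_ok_def by blast

lemma visits_inflow: "inflow W P s v r \<noteq> 0 \<Longrightarrow> visits W P s v \<noteq> 0"
  unfolding visits_def using finite_rob inflow_vert by (subst sum_eq_0_iff) auto

lemma visited_selected:
  assumes "inflow W P s (Task e a p q b) r \<noteq> 0"
  shows "selected P s e a p"
proof -
  let ?v = "Task e a p q b"
  have v: "e \<in> tasks P" "proper_label P e a" "p \<in> clauses P e a" "q \<in> fst p" "b < num q"
    using inflow_vert[OF assms] by (auto simp: task_vert_iff)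
  have "(\<Sum>v\<in>clause_verts e a p. visits W P s v) \<noteq> 0"
    using visits_inflow[OF assms] finite_clause_verts[OF v(3)] v
    by (subst sum_eq_0_iff) (auto simp: clause_vert_iff)
  then have "bcl s e a p \<noteq> 0" using label_constraints(2)[OF v(1,2,3)] by auto
  moreover have "bcl s e a p \<le> 1" using constraints(1) unfolding binary_vars_def by blast
  ultimately show ?thesis using v unfolding selected_def by linarith
qed

text \<open>Makes the sum over clauses that defines \<open>te\<close> collapse to the selected
  clause.\<close>

lemma unselected_times:
  assumes "selected P s e a p" "p' \<in> clauses P e a" "p' \<noteq> p" "v \<in> clause_verts e a p'"
  shows "Tminus W P s v = 0"
proof -
  have e: "e \<in> tasks P" "proper_label P e a" "p \<in> clauses P e a" "bcl s e a p = 1"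
    using assms(1) unfolding selected_def by auto
  have b0: "bcl s e a p' = 0"
    using single_sum(2)[OF finite_clauses _ e(3), of "bcl s e a"] label_constraints(1)[OF e(1,2)] e(4) assms(2,3)
    by simp
  obtain q b where v: "v = Task e a p' q b" "q \<in> fst p'" "b < num q"
    using assms(4) by (rule clause_vertE)
  then have vt: "v \<in> task_verts P" using e assms(2) by (simp add: task_vert_iff)
  have "inflow W P s v r = 0" for r
  proof (rule ccontr)
    assume "inflow W P s v r \<noteq> 0"
    then have "selected P s e a p'" using v(1) visited_selected by blast
    then show False using b0 by (simp add: selected_def)
  qed
  then show ?thesis
    unfolding Tminus_def using no_inflow_times[OF vt] rob_robots[OF vt] by (intro sum.neutral) blast
qed

section \<open>Completion times and their order\<close>

lemma te_edge:
  assumes "inflow W P s (Task e True p q b) r \<noteq> 0"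
  shows "te s e = tminus s (Task e True p q b) r" "tplus s (Task e True p q b) r = te s e"
proof -
  let ?v = "Task e True p q b"
  have vt: "?v \<in> task_verts P" "r \<in> robots W" using inflow_vert[OF assms] by auto
  then have v: "e \<in> tasks P" "proper_label P e True" "p \<in> clauses P e True"
    "?v \<in> clause_verts e True p"
    by (auto simp: task_vert_iff clause_vert_iff)
  note sel = visited_selected[OF assms]
  let ?D = "{p \<in> clauses P e True. clause_verts e True p \<noteq> {}}"
  \<comment> \<open>The completion constraint holds for every choice of representatives. Choosing
    \<open>?v\<close> for its own clause isolates the time at \<open>?v\<close>, since the other
    clauses contribute 0.\<close>
  define f where "f p' = (if p' = p then ?v else (SOME u. u \<in> clause_verts e True p'))" for p'
  have f: "f p' \<in> clause_verts e True p'" if "p' \<in> ?D" for p'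
    using that v(4) some_in_eq by (auto simp: f_def)
  have "te s e = (\<Sum>p\<in>?D. Tminus W P s (f p))"
    using constraints(5) v(1,2) f unfolding completion_ok_def Let_def by blast
  also have "\<dots> = Tminus W P s (f p) + (\<Sum>p\<in>?D - {p}. Tminus W P s (f p))"
    using finite_clauses v(3,4) by (subst sum.remove[of _ p]) auto
  also have "(\<Sum>p\<in>?D - {p}. Tminus W P s (f p)) = 0"
    using unselected_times[OF sel] f by (intro sum.neutral) blast
  finally show te: "te s e = tminus s ?v r" using T_eq[OF assms] by (simp add: f_def)
  have "tminus s ?v r = tplus s ?v r"
    using constraints(2) vt unfolding flow_ok_def by force
  then show "tplus s ?v r = te s e" using te by simp
qed

text \<open>A visited clause is selected, so its big-M term vanishes. The slack 1 is genuine: a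
  starting vertex label has to hold only up to the step before completion.\<close>

lemma te_start:
  assumes "inflow W P s (Task e False p q b) r \<noteq> 0"
  shows "tminus s (Task e False p q b) r \<le> te s e" "te s e \<le> tplus s (Task e False p q b) r + 1"
proof -
  let ?v = "Task e False p q b"
  have v: "e \<in> tasks P" "proper_label P e False" "p \<in> clauses P e False"
    "?v \<in> clause_verts e False p"
    using inflow_vert[OF assms] by (auto simp: task_vert_iff clause_vert_iff)
  have "bcl s e False p = 1" using visited_selected[OF assms] by (simp add: selected_def)
  then show "tminus s ?v r \<le> te s e" "te s e \<le> tplus s ?v r + 1"
    using constraints(5) v T_eq[OF assms] unfolding completion_ok_def by fastforce+
qed

lemma te_covered: "e' \<in> covered_by P e \<Longrightarrow> e \<in> tasks P \<Longrightarrow> te s e' < te s e"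
  using constraints(5) unfolding completion_ok_def by fastforce

text \<open>The MILP constrains covering pairs only. In a finite order these generate all others, by
  induction on the number of subtasks strictly in between.\<close>

lemma te_prec: "(e', e) \<in> prec P \<Longrightarrow> te s e' < te s e"
proof (induction "card {d \<in> tasks P. (e', d) \<in> prec P \<and> (d, e) \<in> prec P}" arbitrary: e' e
    rule: less_induct)
  case less
  let ?B = "\<lambda>x y. {d \<in> tasks P. (x, d) \<in> prec P \<and> (d, y) \<in> prec P}"
  have o: "trans (prec P)" "irrefl (prec P)" "e \<in> tasks P" "e' \<in> tasks P"
    using order less.prems unfolding strict_order_on_def by auto
  show ?case
  proof (cases "?B e' e = {}")
    case True
    then have "e' \<in> covered_by P e" using o less.prems by (auto simp: covered_by_def smaller_def)
    then show ?thesis using te_covered o by blast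
  next
    case False
    then obtain d where d: "d \<in> tasks P" "(e', d) \<in> prec P" "(d, e) \<in> prec P" by auto
    have "?B e' d \<subset> ?B e' e"
      using d o(1,2) unfolding trans_def irrefl_def by blast
    then have "te s e' < te s d" using less.hyps[of e' d] d finite_tasks by (simp add: psubset_card_mono)
    moreover have "?B d e \<subset> ?B e' e"
      using d o(1,2) unfolding trans_def irrefl_def by blast
    then have "te s d < te s e" using less.hyps[of d e] d finite_tasks by (simp add: psubset_card_mono)
    ultimately show ?thesis by simp
  qed
qed

text \<open>Equal times would give \<open>0 \<le> M * b - 1\<close> for both order binaries, making
  both nonzero, whereas they sum to 1.\<close>

lemma te_distinct:
  assumes "e \<in> tasks P" "e' \<in> tasks P" "e \<noteq> e'"
  shows "te s e \<noteq> te s e'"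
proof
  assume eq: "te s e = te s e'"
  have "bafter s e e' + bafter s e' e = 1"
    "int (te s e) - int (te s e') \<le> int M * int (bafter s e e') - 1"
    "int (te s e') - int (te s e) \<le> int M * int (bafter s e' e) - 1"
    using constraints(6) assms unfolding order_ok_def by metis+
  then show False using eq by (cases "bafter s e e' = 0"; cases "bafter s e' e = 0") auto
qed

text \<open>Using the edge switches off the big-M term. The travel time is only bounded below by 0;
  the delay is what the potential argument relies on.\<close>

lemma hop_time:
  assumes "(u, v) \<in> hop r"
  shows "tplus s u r + delay P u v \<le> tminus s v r"
proof -
  have x: "xvar s u v r = 1" using assms by (simp add: hop_def)
  have "enat (tplus s u r) + (travel_time W (loc W P u) (loc W P v) + enat (delay P u v)) * enat (xvar s u v r)
      \<le> enat (tminus s v r + M * (1 - xvar s u v r))"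
    using constraints(3) hopD(1,2)[OF assms] unfolding travel_ok_def by blast
  then have "enat (tplus s u r) + (travel_time W (loc W P u) (loc W P v) + enat (delay P u v)) \<le> enat (tminus s v r)"
    using x by (simp add: one_enat_def[symmetric] del: One_nat_def)
  moreover have "enat (tplus s u r) + enat (delay P u v)
      \<le> enat (tplus s u r) + (travel_time W (loc W P u) (loc W P v) + enat (delay P u v))"
    by (intro add_left_mono) (simp add: add_increasing)
  ultimately have "enat (tplus s u r) + enat (delay P u v) \<le> enat (tminus s v r)"
    by (rule order_trans[rotated])
  then show ?thesis by simp
qed

text \<open>Travel times may vanish, so the times of the MILP need not increase strictly along the route of a
  robot; this potential does.\<close>

fun rank :: "'a rvert \<Rightarrow> nat" where
  "rank (Init r) = 0"
| "rank (Task e a p q b) = Suc (2 * te s e + (if a then 1 else 0))"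

text \<open>Routing edges lead from the starting vertex label to the edge label of the same subtask,
  where the parity bit grows, from a smaller subtask, where \<open>te_prec\<close> applies, or from
  an incomparable one, where the delay decides.\<close>

lemma hop_rank:
  assumes "(u, v) \<in> hop r"
  shows "rank u < rank v"
proof -
  obtain e a p q b where v: "v = Task e a p q b" "e \<in> tasks P"
    using hopD(3)[OF assms] by (rule task_vertE)
  show ?thesis
  proof (cases u)
    case (Init r')
    then show ?thesis using v by simp
  next
    case (Task e' a' p' q' b')
    have e': "e' \<in> tasks P" and u: "u \<in> task_verts P"
      using hopD(1)[OF assms] Task by (auto simp: redges_def rverts_def task_vert_iff)
    have "outflow W P s u r \<le> inflow W P s u r"
      using constraints(2) u hopD(4)[OF assms] unfolding flow_ok_def by blast
    then have inu: "inflow W P s u r \<noteq> 0" using hopD(6)[OF assms] by linarith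
    note inv = hopD(5)[OF assms]
    have "route W P u v" using hopD(1)[OF assms] by (simp add: redges_def)
    then have cases: "(a \<and> e' = e \<and> \<not> a') \<or> (e', e) \<in> prec P \<or>
        (e' \<in> incomp P e \<and> (\<not> a \<longrightarrow> a'))"
      using v Task by (auto simp: smaller_def covered_by_def split: if_splits)
    \<comment> \<open>The delay 1 between incomparable subtasks offsets the slack 1 of
      \<open>te_start\<close>. What remains in the worst case is a weak inequality, which
      \<open>te_distinct\<close> makes strict.\<close>
    have "te s e' < te s e" if "e' \<in> incomp P e" "\<not> a \<longrightarrow> a'"
    proof -
      have "e \<in> incomp P e'" using that v(2) by (auto simp: incomp_def)
      then have "tplus s u r + 1 \<le> tminus s v r" using hop_time[OF assms] v Task by simp
      moreover have "tminus s v r \<le> te s e"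
        using inv v te_edge te_start by (cases a) auto
      moreover have "te s e' \<le> tplus s u r + (if a' then 0 else 1)"
        using inu Task te_edge te_start by (cases a') auto
      moreover have "te s e' \<noteq> te s e" using te_distinct e' v(2) that by (auto simp: incomp_def)
      ultimately show ?thesis by (cases a) (auto split: if_splits)
    qed
    with cases consider "a \<and> e' = e \<and> \<not> a'" | "te s e' < te s e" using te_prec by blast
    then show ?thesis using v Task by cases auto
  qed
qed

text \<open>A robot leaves its initial vertex at most once, and leaves any other vertex at most as
  often as it enters it, which is at most once.\<close>

lemma hop_single_valued: "single_valued (hop r)"
proof (rule single_valuedI)
  fix u v w assume h: "(u, v) \<in> hop r" "(u, w) \<in> hop r"
  have r: "r \<in> robots W" using hopD(4)[OF h(1)] .
  have "outflow W P s u r \<le> 1"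
  proof (cases u)
    case (Init r')
    moreover have "r' \<in> robots W"
      using hopD(1)[OF h(1)] Init by (auto simp: redges_def rverts_def task_verts_def clause_verts_def lit_verts_def)
    ultimately show ?thesis
      using constraints(2) r unfolding flow_ok_def by (cases "r = r'") fastforce+
  next
    case Task
    then have "u \<in> task_verts P" using hopD(1)[OF h(1)] by (auto simp: redges_def rverts_def)
    then have "outflow W P s u r \<le> inflow W P s u r" "visits W P s u \<le> 1"
      using constraints(2) r unfolding flow_ok_def by blast+
    then show ?thesis using inflow_unique(1)[of u r] by (cases "inflow W P s u r = 0") auto
  qed
  then have "xvar s u w r = 0" if "v \<noteq> w"
    using single_sum(2)[OF finite_succs[of u], of "\<lambda>w. xvar s u w r" v w] hopD(1)[OF h(1)]
      hopD(1)[OF h(2)] h that unfolding outflow_def by (auto simp: hop_def)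
  then show "v = w" using h by (auto simp: hop_def)
qed

text \<open>Flow conservation alone would admit circulations that no robot starts. Following a visit
  backwards lowers the rank, so the walk must end in an initial vertex, and only \<open>r\<close>
  may leave \<open>Init r\<close>.\<close>

lemma reachable_from_init:
  assumes "inflow W P s v r \<noteq> 0"
  shows "(Init r, v) \<in> (hop r)\<^sup>*"
  using assms
proof (induction "rank v" arbitrary: v rule: less_induct)
  case less
  obtain u where u: "(u, v) \<in> hop r" using less.prems by (rule inflow_hop)
  have r: "r \<in> robots W" using hopD(4)[OF u] .
  have "(Init r, u) \<in> (hop r)\<^sup>*"
  proof (cases u)
    case (Init r')
    moreover have "r' \<in> robots W"
      using hopD(1)[OF u] Init by (auto simp: redges_def rverts_def task_verts_def clause_verts_def lit_verts_def)
    ultimately have "r' = r"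
      using constraints(2) r hopD(6)[OF u] unfolding flow_ok_def by metis
    then show ?thesis using Init by simp
  next
    case Task
    then have "u \<in> task_verts P" using hopD(1)[OF u] by (auto simp: redges_def rverts_def)
    then have "outflow W P s u r \<le> inflow W P s u r"
      using constraints(2) r unfolding flow_ok_def by blast
    then show ?thesis using less.hyps[OF hop_rank[OF u]] hopD(6)[OF u] by simp
  qed
  then show ?case using u by simp
qed

text \<open>All vertices visited by \<open>r\<close> lie on its one path from \<open>Init r\<close>,
  along which the rank is injective. Vertices of the same label of the same subtask have equal rank,
  so \<open>r\<close> is counted there once.\<close>

lemma rank_unique:
  assumes "inflow W P s v r \<noteq> 0" "inflow W P s v' r \<noteq> 0" "rank v = rank v'"
  shows "v = v'"
proof -
  have mono: "rank x \<le> rank y \<and> (rank x = rank y \<longrightarrow> x = y)" if "(x, y) \<in> (hop r)\<^sup>*" for x y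
    using that by induction (auto dest: hop_rank)
  show ?thesis
    using single_valued_confluent[OF hop_single_valued reachable_from_init[OF assms(1)]
        reachable_from_init[OF assms(2)]] mono assms(3) by metis
qed

section \<open>Teams assigned to the literals of selected clauses\<close>

lemma selected_visit:
  assumes "selected P s e a p" "q \<in> fst p" "b < num q"
  shows "\<exists>r. inflow W P s (Task e a p q b) r = 1"
proof -
  have e: "e \<in> tasks P" "proper_label P e a" "p \<in> clauses P e a" "bcl s e a p = 1"
    using assms(1) unfolding selected_def by auto
  let ?V = "clause_verts e a p"
  have le: "visits W P s v \<le> 1" if "v \<in> ?V" for v
    using that e visits_le by (auto simp: task_vert_iff elim: clause_vertE)
  have fin: "finite ?V" by (rule finite_clause_verts[OF e(3)])
  have v: "Task e a p q b \<in> ?V" using assms by (simp add: clause_vert_iff)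
  \<comment> \<open>The visits add up to the number of vertices and each vertex has at most one, so
    none is left out.\<close>
  have "(\<Sum>v\<in>?V. visits W P s v) = (\<Sum>v\<in>?V. 1)"
    using label_constraints(2)[OF e(1-3)] e(4) card_clause_verts[OF e(3)] by simp
  then have "(\<Sum>v\<in>?V. 1 - visits W P s v) = 0"
    using sum_subtractf_nat[of ?V "visits W P s" "\<lambda>_. 1"] le by simp
  then have "visits W P s (Task e a p q b) = 1"
    using fin v le[OF v] by auto
  then obtain r where "inflow W P s (Task e a p q b) r \<noteq> 0"
    unfolding visits_def by (metis sum.neutral zero_neq_one)
  then show ?thesis using inflow_unique(1) by blast
qed

text \<open>Within a selected clause, vertices and visiting robots correspond one to one: a vertex
  has one visitor by \<open>inflow_unique\<close>, a robot visits one vertex by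
  \<open>rank_unique\<close>. This yields both the sizes and the disjointness of the teams.\<close>

lemma essential_assigned:
  assumes sel: "selected P s e a (pos C, False)"
    and R: "\<forall>q\<in>pos C. R q = essential W P s e a (pos C, False) q"
    and used: "\<forall>(\<chi>, U)\<in>conn_used W P s. \<rho> \<chi> = U"
  shows "assigned W \<rho> R C"
proof -
  let ?p = "(pos C, False)"
  let ?v = "\<lambda>q b. Task e a ?p q b"
  have ess: "r \<in> R q \<longleftrightarrow> (\<exists>b<num q. inflow W P s (?v q b) r = 1)" if "q \<in> pos C" for q r
    using R that by (simp add: essential_def)
  have uniq: "q = q' \<and> b = b'"
    if "inflow W P s (?v q b) r = 1" "inflow W P s (?v q' b') r = 1" for q q' b b' r
    using rank_unique[of "?v q b" r "?v q' b'"] that by simp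
  have "R q \<subseteq> team W (kind q)" if "q \<in> pos C" for q
    using inflow_vert ess[OF that] by (metis (no_types, lifting) rob.simps(2) snd_conv subsetI zero_neq_one)
  moreover have "card (R q) = num q" if q: "q \<in> pos C" for q
  proof -
    define g where "g b = (SOME r. inflow W P s (?v q b) r = 1)" for b
    have g: "inflow W P s (?v q b) (g b) = 1" if "b < num q" for b
      unfolding g_def by (rule someI_ex) (use selected_visit[OF sel, of q b] q that in simp)
    have "R q = g ` {..<num q}"
    proof -
      have "r = g b" if "b < num q" "inflow W P s (?v q b) r = 1" for r b
        using inflow_unique(2)[of "?v q b" r "g b"] that g[OF that(1)] by fastforce
      then show ?thesis using g ess[OF q] by blast
    qed
    moreover have "inj_on g {..<num q}"
      unfolding inj_on_def using g uniq by (metis lessThan_iff)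
    ultimately show ?thesis by (simp add: card_image)
  qed
  moreover have "R q = \<rho> (conn q)" if "q \<in> pos C" "conn q \<noteq> 0" for q
  proof -
    have "(conn q, essential W P s e a ?p q) \<in> conn_used W P s"
      unfolding conn_used_def mem_Collect_eq using sel that
      by (intro exI[of _ e] exI[of _ a] exI[of _ ?p] exI[of _ q]) simp
    then show ?thesis using used R that(1) by auto
  qed
  moreover have "R q \<inter> R q' = {}" if "q \<in> pos C" "q' \<in> pos C" "q \<noteq> q'" for q q'
    using ess[OF that(1)] ess[OF that(2)] uniq that(3) by blast
  ultimately show ?thesis unfolding assigned_def by blast
qed

end

section \<open>Runs along finite and lasso-shaped paths\<close>

text \<open>Every letter is consumed by exactly one transition, matching the indexing in
  \<open>accepts\<close>; dropping the first configuration of a later segment thus glues segments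
  without reading it twice.\<close>

primrec reach :: "('s \<Rightarrow> 'a \<Rightarrow> 'a \<Rightarrow> bool) \<Rightarrow> 'a \<Rightarrow> 's list \<Rightarrow> 'a \<Rightarrow> bool" where
  "reach step u [] v \<longleftrightarrow> u = v"
| "reach step u (c # cs) v \<longleftrightarrow> (\<exists>w. step c u w \<and> reach step w cs v)"

lemma reach_append:
  "reach step u (cs @ ds) v \<longleftrightarrow> (\<exists>w. reach step u cs w \<and> reach step w ds v)"
  by (induction cs arbitrary: u) auto

lemma reach_stay: "\<forall>c\<in>set cs. step c u u \<Longrightarrow> reach step u cs u"
  by (induction cs) auto

lemma reach_concat:
  assumes "\<And>n. n < length ys \<Longrightarrow> reach step (w n) (ys ! n) (w (Suc n))"
  shows "reach step (w 0) (concat ys) (w (length ys))"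
  using assms
proof (induction ys rule: rev_induct)
  case (snoc y ys)
  have "reach step (w 0) (concat ys) (w (length ys))"
  proof (rule snoc.IH)
    show "reach step (w n) (ys ! n) (w (Suc n))" if "n < length ys" for n
      using snoc.prems[of n] that by (simp add: nth_append)
  qed
  moreover have "reach step (w (length ys)) y (w (Suc (length ys)))"
    using snoc.prems[of "length ys"] by (simp add: nth_append)
  ultimately show ?case by (auto simp: reach_append)
qed simp

lemma reach_run:
  assumes "reach step u cs v"
  shows "\<exists>f. f 0 = u \<and> f (length cs) = v \<and> (\<forall>i<length cs. step (cs ! i) (f i) (f (Suc i)))"
  using assms
proof (induction cs arbitrary: u)
  case (Cons c cs)
  then obtain w f where w: "step c u w" and f: "f 0 = w" "f (length cs) = v"
    "\<forall>i<length cs. step (cs ! i) (f i) (f (Suc i))"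
    by auto metis
  have "step ((c # cs) ! i) (case_nat u f i) (case_nat u f (Suc i))" if "i < length (c # cs)" for i
    using that w f by (cases i) auto
  then show ?case using f by (intro exI[of _ "case_nat u f"]) auto
qed auto

lemma lasso_run:
  assumes "reach step u x v" "reach step v y v" "y \<noteq> []"
  shows "\<exists>run. run 0 = u \<and> (\<forall>t. step ((x \<frown> y\<^sup>\<omega>) t) (run t) (run (Suc t))) \<and> v \<in> limit run"
proof -
  obtain f where f: "f 0 = u" "f (length x) = v" "\<forall>i<length x. step (x ! i) (f i) (f (Suc i))"
    using reach_run[OF assms(1)] by blast
  obtain g where g: "g 0 = v" "g (length y) = v" "\<forall>i<length y. step (y ! i) (g i) (g (Suc i))"
    using reach_run[OF assms(2)] by blast
  \<comment> \<open>Both pieces give \<open>v\<close> at time \<open>length x\<close>, and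
    \<open>g\<close> takes the value \<open>v\<close> at both ends of a round, so neither the seam
    nor the wrap-around breaks a transition.\<close>
  define run where "run t = (if t < length x then f t else g ((t - length x) mod length y))" for t
  have y: "0 < length y" using assms(3) by simp
  have fx: "run t = f t" if "t \<le> length x" for t
    using that f g by (cases "t = length x") (auto simp: run_def)
  have "step ((x \<frown> y\<^sup>\<omega>) t) (run t) (run (Suc t))" for t
  proof (cases "t < length x")
    case True
    then show ?thesis using f fx[of t] fx[of "Suc t"] by simp
  next
    case False
    let ?k = "(t - length x) mod length y"
    have "run (Suc t) = g (Suc ?k)"
      using False g by (auto simp: run_def Suc_diff_le mod_Suc)
    moreover have "run t = g ?k" using False by (simp add: run_def)
    moreover have "?k < length y" using y by simp
    ultimately show ?thesis using g False y by simp
  qed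
  moreover have "v \<in> limit run"
    unfolding limit_iff_frequent INFM_nat
  proof
    fix m
    have "run (length x + Suc m * length y) = v" using g by (simp add: run_def)
    moreover have "Suc m * 1 \<le> Suc m * length y" by (rule mult_le_mono2) (use y in linarith)
    then have "m < length x + Suc m * length y" by simp
    ultimately show "\<exists>n>m. run n = v" by blast
  qed
  moreover have "run 0 = u" using fx f by simp
  ultimately show ?thesis by blast
qed

text \<open>Allows the loop to be cut at a position other than its start.\<close>

lemma iter_rotate:
  assumes "b \<noteq> []"
  shows "(a @ b)\<^sup>\<omega> = a \<frown> (b @ a)\<^sup>\<omega>"
proof
  fix t
  show "(a @ b)\<^sup>\<omega> t = (a \<frown> (b @ a)\<^sup>\<omega>) t"
  proof (cases "t < length a")
    case True
    then show ?thesis using assms by (simp add: nth_append)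
  next
    case False
    define k where "k = t - length a"
    define L where "L = length a + length b"
    have t: "t = length a + k" using False by (simp add: k_def)
    have L: "0 < L" "length b \<le> L" using assms by (auto simp: L_def)
    have kL: "k mod L < L" using L by simp
    have tm: "t mod L = (length a + k mod L) mod L" by (simp add: t mod_add_right_eq)
    have "(a @ b) ! (t mod L) = (b @ a) ! (k mod L)"
    proof (cases "k mod L < length b")
      case True
      then have "length a + k mod L < L" by (simp add: L_def)
      then have "t mod L = length a + k mod L" by (simp add: tm)
      then show ?thesis using True by (simp add: nth_append)
    next
      case False
      then have "length a + k mod L = (k mod L - length b) + L" by (simp add: L_def)
      then have "t mod L = (k mod L - length b) mod L" unfolding tm by simp
      also have "\<dots> = k mod L - length b" using kL by (intro mod_less) linarith
      finally have "t mod L = k mod L - length b" .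
      moreover have "k mod L - length b < length a" using False kL L_def by linarith
      ultimately show ?thesis using False by (simp add: nth_append)
    qed
    moreover have "(a @ b)\<^sup>\<omega> t = (a @ b) ! (t mod L)" using assms by (simp add: L_def)
    moreover have "(a \<frown> (b @ a)\<^sup>\<omega>) t = (b @ a) ! (k mod L)"
      using False assms by (simp add: L_def k_def add.commute)
    ultimately show ?thesis by simp
  qed
qed

section \<open>Path segments\<close>

text \<open>For partial execution let \<open>i'\<close> robots of the type be in the region at time
  0, and let \<open>i\<close> be the number in the literal. If \<open>i' < i\<close>, at most
  \<open>i'\<close> of them stay there and fewer than \<open>i - i'\<close> moving robots are
  inside. Otherwise \<open>i' - i + 1\<close> of them belong to the moving robots, so at most
  \<open>i - 1\<close> stay there, and no moving robot is inside.\<close>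

lemma moving_neg:
  assumes W: "workspace W" "kind a < ntyp W" and a: "a \<in> negs Q"
    and rm: "partial I \<Longrightarrow> rminus_ok W Q Rm"
    and few: "card {r \<in> moving W I Q g Rm \<inter> team W (kind a). c r \<in> region W (reg a)} < bound W I Q a"
    and stay: "partial I \<Longrightarrow> \<forall>r\<in>robots W - moving W I Q g Rm. c r = source Q r"
  shows "present W c a < num a"
proof -
  let ?Mv = "moving W I Q g Rm"
  let ?T = "team W (kind a)"
  have T: "finite ?T" "?T \<subseteq> robots W" using finite_team[OF W] team_robots[OF W] by auto
  show ?thesis
  proof (cases "partial I")
    case False
    then have "{r \<in> ?Mv \<inter> ?T. c r \<in> region W (reg a)} = {r \<in> ?T. c r \<in> region W (reg a)}"
      using T by (auto simp: moving_def)
    then show ?thesis using few False by (simp add: present_def bound_def)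
  next
    case True
    let ?m = "{r \<in> ?Mv \<inter> ?T. c r \<in> region W (reg a)}"
    let ?n = "{r \<in> ?T - ?Mv. c r \<in> region W (reg a)}"
    let ?S = "{r \<in> ?T. source Q r \<in> region W (reg a)}"
    have "{r \<in> ?T. c r \<in> region W (reg a)} = ?m \<union> ?n" by auto
    moreover have "card (?m \<union> ?n) = card ?m + card ?n"
      by (rule card_Un_disjoint) (use T(1) in auto)
    ultimately have pr: "present W c a = card ?m + card ?n" by (simp add: present_def)
    have nS: "?n \<subseteq> ?S - ?Mv" using stay[OF True] T(2) by auto
    have i': "present W (source Q) a = card ?S" by (simp add: present_def)
    show ?thesis
    proof (cases "card ?S < num a")
      case less: True
      have "card ?n \<le> card ?S" using nS T(1) by (intro card_mono) auto
      moreover have "card ?m < num a - card ?S" using few True less by (simp add: bound_def i')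
      ultimately show ?thesis using pr less by linarith
    next
      case ge: False
      have rma: "Rm a \<subseteq> ?S" "card (Rm a) = card ?S - num a + 1"
        using rm[OF True, unfolded rminus_ok_def Let_def, THEN bspec, OF a] ge unfolding i' by simp_all
      have "Rm a \<subseteq> ?Mv" using True a by (auto simp: moving_def)
      then have "?n \<subseteq> ?S - Rm a" using nS by blast
      then have "card ?n \<le> card ?S - card (Rm a)"
        using rma(1) T(1) by (metis (no_types, lifting) card_Diff_subset card_mono finite_Diff finite_subset mem_Collect_eq subsetI)
      moreover have "card (Rm a) \<le> card ?S" using rma(1) T(1) by (intro card_mono) auto
      moreover have "card ?m = 0" using few True ge by (simp add: bound_def i')
      ultimately show ?thesis using pr rma(2) ge by linarith
    qed
  qed
qed

lemma gmrpp_feasibleD: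
  assumes "gmrpp_feasible W I Q g Rm T \<sigma>"
  shows "length \<sigma> = Suc T" "\<sigma> ! 0 = source Q"
    and "\<forall>(r, U)\<in>end_targets Q. (\<sigma> ! T) r \<in> U"
    and "\<forall>t\<in>{1..<T}. \<forall>(r, U)\<in>keep_targets Q. (\<sigma> ! t) r \<in> U"
    and "\<forall>t\<in>{1..<T}. \<forall>a\<in>keep_negs Q.
      card {r \<in> moving W I Q g Rm \<inter> team W (kind a). (\<sigma> ! t) r \<in> region W (reg a)} < bound W I Q a"
    and "\<forall>a\<in>end_negs Q.
      card {r \<in> moving W I Q g Rm \<inter> team W (kind a). (\<sigma> ! T) r \<in> region W (reg a)} < bound W I Q a"
    and "partial I \<Longrightarrow> \<forall>r\<in>robots W - moving W I Q g Rm. \<forall>t\<le>T. (\<sigma> ! t) r = source Q r"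
proof -
  note f = assms[unfolded gmrpp_feasible_def Let_def]
  show "length \<sigma> = Suc T" using f by (elim conjE)
  show "\<sigma> ! 0 = source Q" using f by (elim conjE)
  show "\<forall>(r, U)\<in>end_targets Q. (\<sigma> ! T) r \<in> U"
    using f by (elim conjE)
  show "\<forall>t\<in>{1..<T}. \<forall>(r, U)\<in>keep_targets Q. (\<sigma> ! t) r \<in> U"
    using f by (elim conjE)
  show "\<forall>t\<in>{1..<T}. \<forall>a\<in>keep_negs Q.
      card {r \<in> moving W I Q g Rm \<inter> team W (kind a). (\<sigma> ! t) r \<in> region W (reg a)} < bound W I Q a"
    using f by (elim conjE)
  show "\<forall>a\<in>end_negs Q.
      card {r \<in> moving W I Q g Rm \<inter> team W (kind a). (\<sigma> ! T) r \<in> region W (reg a)} < bound W I Q a"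
    using f by (elim conjE)
  show "\<forall>r\<in>robots W - moving W I Q g Rm. \<forall>t\<le>T. (\<sigma> ! t) r = source Q r" if "partial I"
  proof -
    have "partial I \<longrightarrow> (\<forall>r\<in>robots W - moving W I Q g Rm. (\<forall>t\<le>T. (\<sigma> ! t) r = source Q r) \<and>
        (\<forall>t\<in>{1..T}. \<forall>r'\<in>moving W I Q g Rm. (\<sigma> ! t) r' \<noteq> source Q r))"
      using f by (elim conjE)
    then show ?thesis using that by blast
  qed
qed

text \<open>The end targets \<open>E\<close> are left general because the segment returning to the
  start of the loop prescribes single cells; any target contained in the required region will
  do.\<close>

lemma gmrpp_segment:
  assumes W: "workspace W" and ty: "typed W C1" "typed W C"
    and sol: "gmrpp_solution W I
      \<lparr>source = s0, keep_targets = targets W R1 C1, end_targets = E,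
       keep_negs = neg C1, end_negs = neg C, waypoint = wp\<rparr> T \<sigma>" (is "gmrpp_solution W I ?Q T \<sigma>")
  shows "length \<sigma> = Suc T" "\<sigma> ! 0 = s0"
    and "\<And>t. 1 \<le> t \<Longrightarrow> t < T \<Longrightarrow> assigned W \<rho> R1 C1 \<Longrightarrow> sat_clause W \<rho> (\<sigma> ! t) R1 C1"
    and "\<And>R. assigned W \<rho> R C \<Longrightarrow>
      (\<And>q r. q \<in> pos C \<Longrightarrow> r \<in> R q \<Longrightarrow> \<exists>U\<subseteq>region W (reg q). (r, U) \<in> E) \<Longrightarrow> sat_clause W \<rho> (\<sigma> ! T) R C"
proof -
  obtain g Rm where rm: "partial I \<longrightarrow> rminus_ok W ?Q Rm" and
    feas: "gmrpp_feasible W I ?Q g Rm T \<sigma>"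
    using sol unfolding gmrpp_solution_def is_arg_min_def by blast
  let ?Mv = "moving W I ?Q g Rm"
  note f = gmrpp_feasibleD[OF feas]
  show "length \<sigma> = Suc T" "\<sigma> ! 0 = s0" using f(1,2) by simp_all
  have stay: "\<forall>r\<in>robots W - ?Mv. (\<sigma> ! t) r = source ?Q r" if "partial I" "t \<le> T" for t
    using f(7)[OF that(1)] that(2) by blast
  note neg = moving_neg[where I = I and Q = ?Q and g = g and Rm = Rm, OF W]
  have n1: "present W (\<sigma> ! t) a < num a" if "1 \<le> t" "t < T" "a \<in> neg C1" for t a
  proof (rule neg)
    show "kind a < ntyp W" using that(3) ty(1) by (simp add: typed_def)
    show "a \<in> negs ?Q" using that(3) by (simp add: negs_def)
    show "rminus_ok W ?Q Rm" if "partial I" using rm that by blast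
    show "card {r \<in> ?Mv \<inter> team W (kind a). (\<sigma> ! t) r \<in> region W (reg a)} < bound W I ?Q a"
      by (rule f(5)[THEN bspec, THEN bspec]) (use that in simp_all)
    show "\<forall>r\<in>robots W - ?Mv. (\<sigma> ! t) r = source ?Q r" if "partial I"
      using stay[OF that] \<open>t < T\<close> by (metis less_imp_le)
  qed
  have nT: "present W (\<sigma> ! T) a < num a" if "a \<in> neg C" for a
  proof (rule neg)
    show "kind a < ntyp W" using that ty(2) by (simp add: typed_def)
    show "a \<in> negs ?Q" using that by (simp add: negs_def)
    show "rminus_ok W ?Q Rm" if "partial I" using rm that by blast
    show "card {r \<in> ?Mv \<inter> team W (kind a). (\<sigma> ! T) r \<in> region W (reg a)} < bound W I ?Q a"
      by (rule f(6)[THEN bspec]) (use that in simp)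
    show "\<forall>r\<in>robots W - ?Mv. (\<sigma> ! T) r = source ?Q r" if "partial I"
      using stay[OF that] by (metis order_refl)
  qed
  show "sat_clause W \<rho> (\<sigma> ! t) R1 C1" if "1 \<le> t" "t < T" "assigned W \<rho> R1 C1" for t
  proof -
    have "(\<sigma> ! t) r \<in> region W (reg q)" if "q \<in> pos C1" "r \<in> R1 q" for q r
    proof -
      have "(r, region W (reg q)) \<in> keep_targets ?Q" using that by (auto simp: targets_def)
      then show ?thesis using f(4) \<open>1 \<le> t\<close> \<open>t < T\<close> by fastforce
    qed
    then show ?thesis using n1 that by (simp add: sat_clause_iff)
  qed
  show "sat_clause W \<rho> (\<sigma> ! T) R C" if as: "assigned W \<rho> R C"
    and tg: "\<And>q r. q \<in> pos C \<Longrightarrow> r \<in> R q \<Longrightarrow> \<exists>U\<subseteq>region W (reg q). (r, U) \<in> E" for R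
  proof -
    have "(\<sigma> ! T) r \<in> region W (reg q)" if qr: "q \<in> pos C" "r \<in> R q" for q r
    proof -
      obtain U where "U \<subseteq> region W (reg q)" "(r, U) \<in> end_targets ?Q"
        using tg[OF qr] by auto
      then show ?thesis using f(3) by fastforce
    qed
    then show ?thesis using nT as by (simp add: sat_clause_iff)
  qed
qed

text \<open>\<open>C'\<close> may be smaller than \<open>C\<close> since the last subtask of the
  loop satisfies the clause inherited from the prefix, which only implies a clause of the edge
  actually read.\<close>

lemma gmrpp_reach:
  assumes W: "workspace W" and ty: "typed W C1" "typed W C"
    and sol: "gmrpp_solution W I
      \<lparr>source = s0, keep_targets = targets W R1 C1, end_targets = targets W R C,
       keep_negs = neg C1, end_negs = neg C, waypoint = wp\<rparr> T \<sigma>"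
    and T: "1 \<le> T" and as: "assigned W \<rho> R1 C1" "assigned W \<rho> R C"
    and C1: "C1 \<in> \<gamma> u u" and C': "C' \<in> \<gamma> u v" "C' \<subseteq> C"
  shows "hd \<sigma> = s0" "\<sigma> \<noteq> []" "tl \<sigma> \<noteq> []" "sat_clause W \<rho> (last \<sigma>) R C"
    "reach (\<lambda>c u v. sat_label W \<rho> c (\<gamma> u v)) u (tl \<sigma>) v"
proof -
  note seg = gmrpp_segment[OF W ty sol]
  show ne: "\<sigma> \<noteq> []" using seg(1) by auto
  show "hd \<sigma> = s0" using seg(2) ne by (simp add: hd_conv_nth)
  have "length (tl \<sigma>) = T" using seg(1) by simp
  then show "tl \<sigma> \<noteq> []" using T by (metis list.size(3) not_one_le_zero)
  have last: "last \<sigma> = \<sigma> ! T" using seg(1) ne by (simp add: last_conv_nth)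
  have final: "sat_clause W \<rho> (\<sigma> ! T) R C"
    by (rule seg(4)[OF as(2)]) (auto simp: targets_def)
  then show "sat_clause W \<rho> (last \<sigma>) R C" using last by simp
  \<comment> \<open>Times \<open>1\<close> to \<open>T - 1\<close> are read by the self-loop at
    \<open>u\<close>, time \<open>T\<close> by the edge to \<open>v\<close>; for
    \<open>T = 1\<close> no self-loop is taken.\<close>
  have "tl \<sigma> = map ((!) \<sigma>) [1..<T] @ [\<sigma> ! T]"
  proof (rule nth_equalityI)
    show "length (tl \<sigma>) = length (map ((!) \<sigma>) [1..<T] @ [\<sigma> ! T])" using seg(1) T by simp
    show "tl \<sigma> ! i = (map ((!) \<sigma>) [1..<T] @ [\<sigma> ! T]) ! i" if "i < length (tl \<sigma>)" for i
    proof (cases "i = T - 1")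
      case True
      then show ?thesis using that seg(1) T by (simp add: nth_append nth_tl)
    next
      case False
      then have "i < T - 1" using that seg(1) by simp
      then show ?thesis using that seg(1) T by (simp add: nth_append nth_tl)
    qed
  qed
  moreover have "sat_label W \<rho> (\<sigma> ! t) (\<gamma> u u)" if "1 \<le> t" "t < T" for t
    using seg(3)[OF that as(1)] C1 by (auto simp: sat_label_def)
  moreover have "sat_label W \<rho> (\<sigma> ! T) (\<gamma> u v)" by (rule sat_label_mono[OF final C'(2,1)])
  ultimately show "reach (\<lambda>c u v. sat_label W \<rho> c (\<gamma> u v)) u (tl \<sigma>) v"
    by (auto simp: reach_append intro!: exI[of _ u] reach_stay)
qed

text \<open>The first segment is exempt from the condition: it is a single configuration if its
  subtask is completed at time 0.\<close>

lemma last_concat_segments: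
  assumes "\<sigma>s \<noteq> []" "\<And>n. 0 < n \<Longrightarrow> n < length \<sigma>s \<Longrightarrow> tl (\<sigma>s ! n) \<noteq> []"
  shows "last (concat_segments \<sigma>s) = last (last \<sigma>s)"
proof (cases \<sigma>s rule: rev_cases)
  case (snoc ys z)
  show ?thesis
  proof (cases ys)
    case Cons
    then have "tl z \<noteq> []" using assms(2)[of "length ys"] snoc by simp
    then show ?thesis using snoc Cons by (simp add: concat_segments_def last_tl)
  qed (simp add: snoc concat_segments_def)
qed (use assms in simp)

context milp_solution
begin

text \<open>For a relaxed label \<open>\<top>\<close> the chosen clause has no positive literals and
  there is nothing to assign; otherwise the MILP provides the teams.\<close>

lemma chosen_assigned:
  assumes "chosen W P s \<gamma> e a C R" "\<forall>(\<chi>, U)\<in>conn_used W P s. \<rho> \<chi> = U"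
  shows "assigned W \<rho> R C"
  using assms essential_assigned[of e a C R \<rho>] unfolding chosen_def
  by (cases "top_label P e a") (auto simp: assigned_def)

text \<open>If \<open>fin\<close> prescribes the last clause, that clause need not belong to the
  label of the last edge, so membership of \<open>Cs ! n\<close> is claimed only for
  \<open>fin = None\<close>.\<close>

lemma low_level_segment:
  fixes fin :: "(clause \<times> (prp \<Rightarrow> nat set)) option"
  assumes ll: "low_level W I \<rho> P s fin xs es \<sigma>s Cs Rs" and n: "n < length es"
    and es: "es ! n = (u, v)"
    and lab: "typed_labels W (full_lab P)"
    and used: "\<forall>(\<chi>, U)\<in>conn_used W P s. \<rho> \<chi> = U"
    and fin: "\<And>Cf Rf. fin = Some (Cf, Rf) \<Longrightarrow> n = length es - 1 \<Longrightarrow>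
      assigned W \<rho> Rf Cf \<and> typed W Cf \<and> (\<exists>C'\<in>full_lab P u v. C' \<subseteq> Cf)"
  shows "if n = 0 \<and> te s (xs ! 0) = 0
    then \<sigma>s ! n = [start P] \<and> Cs ! n \<in> full_lab P u v \<and> sat_clause W \<rho> (start P) (Rs ! n) (Cs ! n)
    else \<sigma>s ! n = (if n = 0 then start P else last (\<sigma>s ! (n - 1))) # tl (\<sigma>s ! n) \<and> tl (\<sigma>s ! n) \<noteq> [] \<and>
      sat_clause W \<rho> (last (\<sigma>s ! n)) (Rs ! n) (Cs ! n) \<and> (fin = None \<longrightarrow> Cs ! n \<in> full_lab P u v) \<and>
      reach (\<lambda>c u v. sat_label W \<rho> c (full_lab P u v)) u (tl (\<sigma>s ! n)) v"
proof -
  let ?s0 = "if n = 0 then start P else last (\<sigma>s ! (n - 1))"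
  let ?C = "Cs ! n" and ?R = "Rs ! n" and ?e = "xs ! n"
  have step: "if n = 0 \<and> te s ?e = 0
        then \<sigma>s ! n = [?s0] \<and> ?C \<in> full_lab P u v \<and> sat_clause W \<rho> ?s0 ?R ?C
        else
          (case fin of
             None \<Rightarrow> chosen W P s (full_lab P u v) ?e True ?C ?R
           | Some (Cf, Rf) \<Rightarrow>
               if n = length es - 1 then ?C = Cf \<and> ?R = Rf
               else chosen W P s (full_lab P u v) ?e True ?C ?R) \<and>
          (\<exists>C1 R1 T.
             chosen W P s (full_lab P u u) ?e False C1 R1 \<and>
             (top_label P ?e False \<longrightarrow>
                (if n = 0 then sat_clause W \<rho> ?s0 R1 C1 else C1 \<subseteq> Cs ! (n - 1))) \<and>
             1 \<le> T \<and>
             gmrpp_solution W I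
               \<lparr>source = ?s0, keep_targets = targets W R1 C1, end_targets = targets W ?R ?C,
                keep_negs = neg C1, end_negs = neg ?C, waypoint = next_waypoint W P s xs n\<rparr>
               T (\<sigma>s ! n))"
    using ll n es unfolding low_level_def Let_def by (metis fst_conv snd_conv)
  show ?thesis
  proof (cases "n = 0 \<and> te s (xs ! 0) = 0")
    case True
    then show ?thesis using step by simp
  next
    case False
    then have F: "\<not> (n = 0 \<and> te s ?e = 0)" by metis
    note st = step[unfolded if_not_P[OF F]]
    obtain C1 R1 T where C1: "chosen W P s (full_lab P u u) ?e False C1 R1" "1 \<le> T"
      and sol: "gmrpp_solution W I
               \<lparr>source = ?s0, keep_targets = targets W R1 C1, end_targets = targets W ?R ?C,
                keep_negs = neg C1, end_negs = neg ?C, waypoint = next_waypoint W P s xs n\<rparr>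
               T (\<sigma>s ! n)"
      using st by blast
    have C1l: "C1 \<in> full_lab P u u" using C1(1) by (simp add: chosen_def)
    have C: "assigned W \<rho> ?R ?C \<and> typed W ?C \<and> (\<exists>C'\<in>full_lab P u v. C' \<subseteq> ?C) \<and>
        (fin = None \<longrightarrow> ?C \<in> full_lab P u v)"
    proof (cases "fin \<noteq> None \<and> n = length es - 1")
      case True
      then obtain Cf Rf where "fin = Some (Cf, Rf)" by auto
      then show ?thesis using st True fin by auto
    next
      case False
      then have ch: "chosen W P s (full_lab P u v) ?e True ?C ?R"
        using st by (auto split: option.splits)
      then have "?C \<in> full_lab P u v" by (simp add: chosen_def)
      then show ?thesis using chosen_assigned[OF ch used] lab by (auto simp: typed_labels_def)
    qed
    then obtain C' where C': "C' \<in> full_lab P u v" "C' \<subseteq> ?C" by blast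
    have ty: "typed W C1" using lab C1l by (auto simp: typed_labels_def)
    have "typed W ?C" "assigned W \<rho> ?R ?C" using C by auto
    note g = gmrpp_reach[where \<gamma> = "full_lab P" and u = u and v = v,
        OF ws ty this(1) sol C1(2) chosen_assigned[OF C1(1) used] this(2) C1l C']
    have "\<sigma>s ! n = ?s0 # tl (\<sigma>s ! n)" using list.collapse[OF g(2)] unfolding g(1) by (rule sym)
    then show ?thesis unfolding if_not_P[OF False] using g(3-5) C by (intro conjI) simp_all
  qed
qed

end

section \<open>Concatenated segments\<close>

lemma strict_order_list_order:
  assumes "distinct xs" "set xs = X"
  shows "strict_order_on X (list_order xs)"
  unfolding strict_order_on_def
proof (intro conjI)
  show "list_order xs \<subseteq> X \<times> X" using assms(2) by (auto simp: list_order_def)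
  show "irrefl (list_order xs)"
    unfolding irrefl_def list_order_def using assms(1) by (auto simp: nth_eq_iff_index_eq)
  show "trans (list_order xs)"
  proof (rule transI)
    fix x y z assume "(x, y) \<in> list_order xs" "(y, z) \<in> list_order xs"
    then obtain i j j' k where ij: "x = xs ! i" "y = xs ! j" "i < j" "j < length xs"
      and jk: "y = xs ! j'" "z = xs ! k" "j' < k" "k < length xs"
      by (auto simp: list_order_def)
    then have "j = j'" using assms(1) by (simp add: nth_eq_iff_index_eq)
    then have "x = xs ! i \<and> z = xs ! k \<and> i < k \<and> k < length xs" using ij jk by auto
    then show "(x, z) \<in> list_order xs" unfolding list_order_def by blast
  qed
qed

lemma admissible_poset_order:
  assumes "admissible_poset X \<Xi> P" "\<And>xs. xs \<in> \<Xi> \<Longrightarrow> distinct xs \<and> set xs = X"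
  shows "strict_order_on X P"
proof -
  obtain Pm where "strict_order_on X Pm" "P = Pm \<or> (\<exists>xs\<in>\<Xi> - lin_exts X Pm. P = list_order xs)"
    using assms(1) unfolding admissible_poset_def max_poset_def by auto
  then show ?thesis using assms(2) strict_order_list_order by (metis DiffD1)
qed

lemma milp_solutionI:
  assumes W: "workspace W" and lab: "typed_labels W (full_lab P)"
    and extra: "\<And>c f. extra P = Some (c, f) \<Longrightarrow> finite c \<and> (\<forall>q\<in>c. \<forall>b<num q. f q b \<in> robots W)"
    and syn: "synthesis W I \<alpha> M \<rho> v0 va P L fin s us \<sigma>s Cs Rs"
  shows "milp_solution W M P s"
proof
  show "workspace W" by (rule W)
  show "finite (tasks P)" using syn unfolding synthesis_def by (metis List.finite_set)
  show "strict_order_on (tasks P) (prec P)"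
    by (rule admissible_poset_order)
      (use syn in \<open>auto simp: synthesis_def path_orders_def\<close>)
  show "milp_base W M P s" using syn unfolding synthesis_def is_arg_min_def by blast
  have clauses_cases: "(\<exists>u v C. C \<in> full_lab P u v \<and> p = (pos C, False)) \<or> (\<exists>c f. extra P = Some (c, f) \<and> p = (c, True))"
    if "p \<in> clauses P e a" for e a p
    using that
    by (auto simp: clauses_def edge_label_def start_label_def relax_def split: if_splits option.splits)
  have fin: "finite (full_lab P u v)" for u v using lab by (simp add: typed_labels_def)
  have "finite (edge_label (full_lab P) e)" "finite (start_label (full_lab P) (graph P) e)" for e
    using fin by (simp_all add: edge_label_def start_label_def relax_def)
  then show "finite (clauses P e a)" for e a
    by (auto simp: clauses_def split: option.splits)
  have pos: "finite (pos C)" "q \<in> pos C \<Longrightarrow> kind q < ntyp W" if "C \<in> full_lab P u v" for C u v q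
    using lab that finite_pos_neg unfolding typed_labels_def typed_def by blast+
  show "finite (fst p)" if "p \<in> clauses P e a" for e a p
    using clauses_cases[OF that] pos(1) extra by auto
  show "rob W P v \<subseteq> robots W" if vt: "v \<in> task_verts P" for v
  proof -
    obtain e a p q b where v: "v = Task e a p q b" "p \<in> clauses P e a" "q \<in> fst p" "b < num q"
      using vt unfolding task_verts_def clause_verts_def lit_verts_def by blast
    from clauses_cases[OF v(2)] show ?thesis
    proof
      assume "\<exists>u v C. C \<in> full_lab P u v \<and> p = (pos C, False)"
      then have "\<not> snd p" "kind q < ntyp W" using v(3) pos(2) by auto
      then show ?thesis using team_robots[OF W] v(1) by simp
    next
      assume "\<exists>c f. extra P = Some (c, f) \<and> p = (c, True)"
      then show ?thesis using v extra by auto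
    qed
  qed
qed

lemma edges_of_nth: "n < length us - 1 \<Longrightarrow> edges_of us ! n = (us ! n, us ! Suc n)"
  by (simp add: edges_of_def nth_butlast nth_tl)

lemma length_edges_of: "length (edges_of us) = length us - 1"
  by (simp add: edges_of_def)

text \<open>Common to prefix and loop. The first segment is treated apart because its start
  configuration must be read as well, whereas each later segment starts with a configuration already
  read.\<close>

lemma synthesis_reach:
  fixes fin :: "(clause \<times> (prp \<Rightarrow> nat set)) option"
  defines "step \<equiv> \<lambda>\<rho> W (P :: ('a, 'c) problem) c u v. sat_label W \<rho> c (full_lab P u v)"
  assumes W: "workspace W" and lab: "typed_labels W (full_lab P)"
    and extra: "\<And>c f. extra P = Some (c, f) \<Longrightarrow> finite c \<and> (\<forall>q\<in>c. \<forall>b<num q. f q b \<in> robots W)"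
    and syn: "synthesis W I \<alpha> M \<rho> v0 va P L fin s us \<sigma>s Cs Rs"
    and fin: "\<And>Cf Rf. fin = Some (Cf, Rf) \<Longrightarrow>
      assigned W \<rho> Rf Cf \<and> typed W Cf \<and> (\<exists>C'\<in>full_lab P (last (butlast us)) va. C' \<subseteq> Cf)"
    and loop: "(v0, v0) \<in> graph P \<Longrightarrow> sat_label W \<rho> (start P) (full_lab P v0 v0)"
  shows "Suc (length \<sigma>s) = length us" "\<sigma>s \<noteq> []" "us ! 0 = v0" "us ! length \<sigma>s = va"
    and "\<And>n. 0 < n \<Longrightarrow> n < length \<sigma>s \<Longrightarrow>
      tl (\<sigma>s ! n) \<noteq> [] \<and> reach (step \<rho> W P) (us ! n) (tl (\<sigma>s ! n)) (us ! Suc n)"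
    and "reach (step \<rho> W P) v0 (hd \<sigma>s) (us ! 1)"
    and "(v0, v0) \<notin> graph P \<Longrightarrow> hd \<sigma>s = [start P]"
    and "fin = None \<Longrightarrow> sat_clause W \<rho> (last (last \<sigma>s)) (last Rs) (last Cs) \<and>
      last Cs \<in> full_lab P (last (butlast us)) va"
proof -
  interpret milp_solution W M P s by (rule milp_solutionI[OF W lab extra syn])
  have path: "path_between (graph P) v0 va us"
    using syn unfolding synthesis_def simple_path_def by blast
  then have us: "2 \<le> length us" "hd us = v0" "last us = va" by (auto simp: path_between_def)
  let ?es = "edges_of us"
  obtain xs where xs: "set xs = tasks P"
    "list_all2 (same_subtask (full_lab P) (graph P) v0 va) xs ?es"
    and ll: "low_level W I \<rho> P s fin xs ?es \<sigma>s Cs Rs"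
    using syn unfolding synthesis_def by blast
  have used: "\<forall>(\<chi>, U)\<in>conn_used W P s. \<rho> \<chi> = U" using syn unfolding synthesis_def by blast
  have len: "length \<sigma>s = length us - 1" "length Cs = length us - 1" "length Rs = length us - 1"
    "length xs = length us - 1"
    using ll length_edges_of[of us] unfolding low_level_def by auto
  show l: "Suc (length \<sigma>s) = length us" using len us(1) by linarith
  show ne: "\<sigma>s \<noteq> []" using l us(1) by auto
  show v0: "us ! 0 = v0" using us by (metis hd_conv_nth list.size(3) not_numeral_le_zero)
  have usne: "us \<noteq> []" using us(1) by auto
  show va: "us ! length \<sigma>s = va" using us(3) usne len(1) by (simp add: last_conv_nth)
  have lb: "last (butlast us) = us ! (length \<sigma>s - 1)"
    using us(1) len(1) by (subst last_conv_nth) (auto simp: nth_butlast simp flip: length_0_conv)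
  have edge: "?es ! n = (us ! n, us ! Suc n)" if "n < length \<sigma>s" for n
    using that len edges_of_nth by simp
  have seg: "if n = 0 \<and> te s (xs ! 0) = 0
    then \<sigma>s ! n = [start P] \<and> Cs ! n \<in> full_lab P (us ! n) (us ! Suc n) \<and> sat_clause W \<rho> (start P) (Rs ! n) (Cs ! n)
    else \<sigma>s ! n = (if n = 0 then start P else last (\<sigma>s ! (n - 1))) # tl (\<sigma>s ! n) \<and> tl (\<sigma>s ! n) \<noteq> [] \<and>
      sat_clause W \<rho> (last (\<sigma>s ! n)) (Rs ! n) (Cs ! n) \<and> (fin = None \<longrightarrow> Cs ! n \<in> full_lab P (us ! n) (us ! Suc n)) \<and>
      reach (step \<rho> W P) (us ! n) (tl (\<sigma>s ! n)) (us ! Suc n)" if "n < length \<sigma>s" for n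
    unfolding step_def
  proof (rule low_level_segment[OF ll _ edge[OF that] lab used])
    show "n < length ?es" using that len length_edges_of[of us] by simp
    show "assigned W \<rho> Rf Cf \<and> typed W Cf \<and> (\<exists>C'\<in>full_lab P (us ! n) (us ! Suc n). C' \<subseteq> Cf)"
      if "fin = Some (Cf, Rf)" "n = length ?es - 1" for Cf Rf
    proof -
      have "n = length \<sigma>s - 1" "Suc n = length \<sigma>s" using that(2) len us(1) length_edges_of[of us] by linarith+
      then show ?thesis using fin[OF that(1)] lb va by simp
    qed
  qed
  show mid: "tl (\<sigma>s ! n) \<noteq> [] \<and> reach (step \<rho> W P) (us ! n) (tl (\<sigma>s ! n)) (us ! Suc n)"
    if "0 < n" "n < length \<sigma>s" for n
    using seg[OF that(2)] that(1) by auto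
  let ?e = "xs ! 0"
  have "0 < length \<sigma>s" using ne by simp
  note seg0 = seg[OF this] and edge0 = edge[OF this]
  have e: "?e \<in> tasks P" using xs(1) len ne \<open>0 < length \<sigma>s\<close> by (metis nth_mem)
  \<comment> \<open>The subtask \<open>?e\<close> of the MILP may be another edge than the first one
    of \<open>us\<close>; identification preserves the starting vertex label and hence whether it is
    empty.\<close>
  have "same_subtask (full_lab P) (graph P) v0 va ?e (?es ! 0)"
    using xs(2) \<open>0 < length \<sigma>s\<close> len by (simp add: list_all2_nthD)
  then have sl: "start_label (full_lab P) (graph P) ?e = start_label (full_lab P) (graph P) (v0, us ! 1)"
    using edge0 v0 unfolding same_subtask_def by auto
  have te0: "te s ?e = 0" if "(v0, v0) \<notin> graph P"
  proof -
    have "clauses P ?e False = {}" using that sl by (simp add: clauses_def start_label_def)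
    then show ?thesis using constraints(5) e unfolding completion_ok_def by blast
  qed
  have hd: "hd \<sigma>s = \<sigma>s ! 0" using ne by (simp add: hd_conv_nth)
  show "hd \<sigma>s = [start P]" if "(v0, v0) \<notin> graph P" using seg0 te0[OF that] hd by simp
  show "reach (step \<rho> W P) v0 (hd \<sigma>s) (us ! 1)"
  proof (cases "te s ?e = 0")
    case True
    then have "\<sigma>s ! 0 = [start P]" "sat_label W \<rho> (start P) (full_lab P v0 (us ! 1))"
      using seg0 v0 by (auto simp: sat_label_def)
    then show ?thesis using hd by (simp add: step_def)
  next
    case False
    then have "\<sigma>s ! 0 = start P # tl (\<sigma>s ! 0)" "reach (step \<rho> W P) v0 (tl (\<sigma>s ! 0)) (us ! 1)"
      using seg0 v0 by auto
    \<comment> \<open>A positive completion time is possible only if the self-loop at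
      \<open>v0\<close> was kept, and then it holds at the start configuration.\<close>
    moreover have "step \<rho> W P (start P) v0 v0" using loop te0 False by (auto simp: step_def)
    ultimately show ?thesis using hd by (metis reach.simps(2))
  qed
  have "length \<sigma>s - 1 < length \<sigma>s" using ne by simp
  note segl = seg[OF this]
  show "sat_clause W \<rho> (last (last \<sigma>s)) (last Rs) (last Cs) \<and>
      last Cs \<in> full_lab P (last (butlast us)) va" if "fin = None"
  proof -
    have "Cs \<noteq> []" "Rs \<noteq> []" using len ne by auto
    then have ls: "last \<sigma>s = \<sigma>s ! (length \<sigma>s - 1)" "last Cs = Cs ! (length \<sigma>s - 1)"
      "last Rs = Rs ! (length \<sigma>s - 1)"
      using ne len by (simp_all add: last_conv_nth)
    have "us ! Suc (length \<sigma>s - 1) = va" using va ne by simp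
    then show ?thesis unfolding ls lb using segl that by (auto split: if_splits)
  qed
qed

section \<open>Prefix and loop\<close>

lemma sub_minus_edge: "e \<in> sub_minus \<gamma> sat v0 va E \<Longrightarrow> e \<in> E"
  by (auto simp: sub_minus_def sub_edges_def restrict_edges_def Let_def split: if_splits)

lemma sub_minus_loop: "(v0, v0) \<in> sub_minus \<gamma> sat v0 va E \<Longrightarrow> sat (\<gamma> v0 v0)"
  by (auto simp: sub_minus_def sub_edges_def restrict_edges_def Let_def split: if_splits)

lemma pruned_loop_implied:
  assumes "(u, v) \<in> pruned_edges G" "u \<noteq> v" "v \<notin> accs G"
  shows "implies (lab G u v) (lab G v v)"
  using assms by (auto simp: pruned_edges_def Let_def implies_s_def)

lemma suffix_graphD:
  assumes "(u, v) \<in> suffix_graph G va \<gamma>in"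
  shows "(u, v) \<in> pruned_edges G" "v \<notin> accs G - {va}" "(u, v) \<noteq> (va, va)"
    and "u = va \<or> v = va \<Longrightarrow> implies \<gamma>in (lab G u v)"
  using assms by (auto simp: suffix_graph_def restrict_edges_def Let_def)

text \<open>The last three conclusions are the interface to the loop: it closes through the clause
  \<open>Cp\<close> satisfied at the end of the prefix.\<close>

lemma prefix_reach:
  assumes W: "workspace W" and lab: "typed_labels W (lab G)"
    and pre: "prefix_synthesis W I \<alpha> M G \<rho> va pre vp Cp Rp used"
  shows "\<exists>v0\<in>inits G. reach (\<lambda>c u v. sat_label W \<rho> c (lab G u v)) v0 pre va"
    and "va \<in> accs G" and "sat_clause W \<rho> (last pre) Rp Cp" and "Cp \<in> lab G vp va"
proof -
  obtain v0 P s us \<sigma>s Cs Rs el pl where v0: "v0 \<in> inits G" and va: "va \<in> accs G"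
    and P: "full_lab P = lab G" "start P = init_conf W" "extra P = None"
    "graph P = sub_minus (lab G) (sat_label W \<rho> (init_conf W)) v0 va (prefix_graph G v0 va)"
    and syn: "synthesis W I \<alpha> M \<rho> v0 va P (prefix_last_ok P el pl) None s us \<sigma>s Cs Rs"
    and eq: "pre = concat_segments \<sigma>s" "vp = last (butlast us)" "Cp = last Cs" "Rp = last Rs"
    using pre unfolding prefix_synthesis_def by blast
  have loop: "(v0, v0) \<in> graph P \<Longrightarrow> sat_label W \<rho> (start P) (full_lab P v0 v0)"
    unfolding P by (rule sub_minus_loop)
  have lab': "typed_labels W (full_lab P)" using lab P by simp
  note r = synthesis_reach[OF W lab' _ syn _ loop, unfolded P(3), simplified]
  show "va \<in> accs G" by (rule va)
  have l: "last pre = last (last \<sigma>s)" unfolding eq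
    by (rule last_concat_segments) (use r(2,5) in auto)
  then show "sat_clause W \<rho> (last pre) Rp Cp" "Cp \<in> lab G vp va"
    using r(8) P(1) by (simp_all add: eq)
  let ?step = "\<lambda>c u v. sat_label W \<rho> c (lab G u v)"
  let ?ys = "hd \<sigma>s # map tl (tl \<sigma>s)"
  have ly: "length ?ys = length \<sigma>s" using r(2) by (cases \<sigma>s) auto
  have "reach ?step (us ! 0) (concat ?ys) (us ! length ?ys)"
  proof (rule reach_concat)
    fix n assume n: "n < length ?ys"
    show "reach ?step (us ! n) (?ys ! n) (us ! Suc n)"
    proof (cases n)
      case 0
      then show ?thesis using r(6) r(3) P(1) by simp
    next
      case (Suc m)
      then have "?ys ! n = tl (\<sigma>s ! n)" using n ly by (simp add: nth_tl)
      then show ?thesis using r(5)[of n] Suc n ly P(1) by simp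
    qed
  qed
  then have "reach ?step v0 pre va" unfolding ly r(3,4) eq concat_segments_def by simp
  then show "\<exists>v0\<in>inits G. reach ?step v0 pre va" using v0 by blast
qed

text \<open>The loop starts and ends at the same configuration, which satisfies \<open>Cp\<close> and thus occurs twice
  in a row. On the way back every configuration satisfies \<open>Cp\<close> as well, so the automaton
  moves on from \<open>va\<close> to the first vertex \<open>v1\<close> of the cycle and waits there; the loop is therefore
  cut at a visit of \<open>va\<close> in its middle.\<close>

lemma suffix_reach:
  assumes W: "workspace W" and lab: "typed_labels W (lab G)"
    and suf: "suffix_synthesis W I \<alpha> M G \<rho> va sp vp Cp Rp used suf"
    and va: "va \<in> accs G" and sat: "sat_clause W \<rho> sp Rp Cp" and Cp: "Cp \<in> lab G vp va"
  shows "\<exists>x y. suf\<^sup>\<omega> = x \<frown> y\<^sup>\<omega> \<and> y \<noteq> [] \<and>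
    reach (\<lambda>c u v. sat_label W \<rho> c (lab G u v)) va x va \<and>
    reach (\<lambda>c u v. sat_label W \<rho> c (lab G u v)) va y va"
proof -
  let ?step = "\<lambda>c u v. sat_label W \<rho> c (lab G u v)"
  show ?thesis
  proof (cases "(va, va) \<in> pruned_edges G \<and> sat_label W \<rho> sp (lab G va va)")
    case True
    then have "suf = [sp]" using suf by (simp add: suffix_synthesis_def)
    then show ?thesis using True by (intro exI[of _ "[]"] exI[of _ "[sp]"]) auto
  next
    case False
    obtain P f s us \<sigma>s Cs Rs T \<sigma> L
      where f: "\<forall>q\<in>pos Cp. bij_betw (f q) {..<num q} (Rp q)"
      and P: "full_lab P = lab G" "start P = sp" "extra P = Some (pos Cp, f)"
        "graph P = sub_minus (lab G) (sat_label W \<rho> sp) va va (suffix_graph G va (lab G vp va))"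
      and syn: "synthesis W I \<alpha> M \<rho> va va P L (Some (Cp, Rp)) s us \<sigma>s Cs Rs"
      and sol: "gmrpp_solution W I
          \<lparr>source = last (last \<sigma>s), keep_targets = targets W Rp Cp,
           end_targets = {(r, {sp r}) | r. r \<in> robots W},
           keep_negs = neg Cp, end_negs = neg Cp, waypoint = (\<lambda>_ _. False)\<rparr> T \<sigma>"
      and eq: "suf = concat_segments (\<sigma>s @ [\<sigma>])"
      using suf unfolding suffix_synthesis_def if_not_P[OF False] by blast
    have as: "assigned W \<rho> Rp Cp" using sat by (simp add: sat_clause_iff)
    have ty: "typed W Cp" using Cp lab by (auto simp: typed_labels_def)
    have Rp: "Rp q \<subseteq> robots W" if "q \<in> pos Cp" for q
      using as ty team_robots[OF W, of "kind q"] that unfolding assigned_def typed_def by blast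
    have lab': "typed_labels W (full_lab P)" using lab P by simp
    have extra: "finite c \<and> (\<forall>q\<in>c. \<forall>b<num q. g q b \<in> robots W)" if "extra P = Some (c, g)" for c g
    proof -
      have "c = pos Cp" "g = f" using that P(3) by auto
      moreover have "finite (pos Cp)" using ty finite_pos_neg by (auto simp: typed_def)
      moreover have "f q b \<in> robots W" if "q \<in> pos Cp" "b < num q" for q b
        using f that Rp[OF that(1)] by (auto simp: bij_betw_def)
      ultimately show ?thesis by blast
    qed
    have path: "path_between (graph P) va va us"
      using syn unfolding synthesis_def simple_path_def by blast
    have edge: "(u, v) \<in> suffix_graph G va (lab G vp va) \<and> u \<noteq> v" if "(u, v) \<in> set (edges_of us)" for u v
      using path that sub_minus_edge P(4) unfolding path_between_def by fastforce
    \<comment> \<open>Hence the first subtask of the loop is completed at time 0 and its segment is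
      just \<open>sp\<close>.\<close>
    have no_loop: "(va, va) \<notin> graph P" using P(4) sub_minus_edge suffix_graphD(3) by metis
    have us: "2 \<le> length us" "hd us = va" "last us = va"
      using path unfolding path_between_def by blast+
    have us0: "us ! 0 = va" using us(1,2) by (cases us) auto
    have nth_edge: "(us ! n, us ! Suc n) \<in> set (edges_of us)" if "Suc n < length us" for n
      using that edges_of_nth[of n us] length_edges_of[of us] nth_mem[of n "edges_of us"] by simp
    have implied: "\<exists>C'\<in>lab G u v. C' \<subseteq> Cp" if "(u, v) \<in> set (edges_of us)" "u = va \<or> v = va" for u v
    proof -
      have "implies (lab G vp va) (lab G u v)"
        using edge[OF that(1)] that(2) suffix_graphD(4) by metis
      then show ?thesis using Cp by (auto simp: implies_def)
    qed
    have last_edge: "(last (butlast us), va) \<in> set (edges_of us)"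
    proof -
      have "last (butlast us) = us ! (length us - 2)"
      proof -
        have "length (butlast us) = Suc (length us - 2)" using us(1) by simp
        then show ?thesis
          by (metis Suc_diff_1 diff_Suc_1 last_conv_nth length_greater_0_conv lessI nth_butlast zero_less_Suc)
      qed
      moreover have "va = us ! Suc (length us - 2)"
      proof -
        have "Suc (length us - 2) = length us - 1" "us \<noteq> []" using us(1) by auto
        then show ?thesis using us(3) by (simp add: last_conv_nth)
      qed
      ultimately show ?thesis using nth_edge[of "length us - 2"] us(1) by simp
    qed
    have fin: "assigned W \<rho> Rf Cf \<and> typed W Cf \<and> (\<exists>C'\<in>full_lab P (last (butlast us)) va. C' \<subseteq> Cf)"
      if "Some (Cp, Rp) = Some (Cf, Rf)" for Cf Rf
      using that as ty implied[OF last_edge] P(1) by simp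
    have loop: "(va, va) \<in> graph P \<Longrightarrow> sat_label W \<rho> (start P) (full_lab P va va)"
      using no_loop by blast
    note r = synthesis_reach[OF W lab' extra syn fin loop, simplified, unfolded P(1,2)]
    let ?v1 = "us ! 1"
    have e1: "(va, ?v1) \<in> set (edges_of us)" using nth_edge[of 0] us(1) us0 by simp
    have v1: "?v1 \<noteq> va" "(va, ?v1) \<in> pruned_edges G" "?v1 \<notin> accs G"
      using edge[OF e1] suffix_graphD(1,2)[of va ?v1 G va] by auto
    \<comment> \<open>\<open>Cp\<close> contains a clause of the first edge by the choice of edges
      at \<open>va\<close>. As \<open>?v1\<close> is not accepting, pruning ensures that this clause
      contains one of the self-loop at \<open>?v1\<close>. So any configuration satisfying
      \<open>Cp\<close> allows both entering \<open>?v1\<close> and waiting there.\<close>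
    obtain C1 where C1: "C1 \<in> lab G va ?v1" "C1 \<subseteq> Cp" using implied[OF e1] by blast
    then obtain C2 where C2: "C2 \<in> lab G ?v1 ?v1" "C2 \<subseteq> Cp"
      using pruned_loop_implied[OF v1(2)] v1 unfolding implies_def by (metis order_trans)
    have to_v1: "?step c va ?v1" and at_v1: "?step c ?v1 ?v1" if "sat_clause W \<rho> c Rp Cp" for c
      using sat_label_mono[OF that] C1 C2 by blast+
    \<comment> \<open>\<open>a\<close> collects the subtasks after the first and leads to
      \<open>va\<close>; \<open>b\<close> is the return to \<open>sp\<close>.\<close>
    define a where "a = concat (map tl (tl \<sigma>s))"
    define b where "b = tl \<sigma>"
    have \<sigma>s: "\<sigma>s \<noteq> []" "hd \<sigma>s = [sp]" using r(2,7) no_loop by auto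
    have suf: "suf = ([sp] @ a) @ b"
      using \<sigma>s unfolding eq concat_segments_def a_def b_def by simp
    have ra: "reach ?step ?v1 a va"
    proof -
      have ly: "Suc (length (map tl (tl \<sigma>s))) = length \<sigma>s" using \<sigma>s(1) by (cases \<sigma>s) auto
      have "reach ?step (us ! Suc 0) a (us ! Suc (length (map tl (tl \<sigma>s))))"
        unfolding a_def
      proof (rule reach_concat)
        fix n assume n: "n < length (map tl (tl \<sigma>s))"
        then show "reach ?step (us ! Suc n) (map tl (tl \<sigma>s) ! n) (us ! Suc (Suc n))"
          using r(5)[of "Suc n"] ly by (simp add: nth_tl)
      qed
      then show ?thesis unfolding ly r(4) by simp
    qed
    have rb: "\<forall>c\<in>set b. sat_clause W \<rho> c Rp Cp"
    proof
      note seg = gmrpp_segment[OF W ty ty sol]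
      fix c assume "c \<in> set b"
      then obtain i where i: "i < T" "c = \<sigma> ! Suc i"
        using seg(1) by (auto simp: b_def in_set_conv_nth nth_tl)
      \<comment> \<open>The end targets are the cells of \<open>sp\<close>, which lie in the
        required regions because \<open>sp\<close> satisfies \<open>Cp\<close>.\<close>
      have final: "sat_clause W \<rho> (\<sigma> ! T) Rp Cp"
        by (rule seg(4)[OF as]) (use Rp sat in \<open>fastforce simp: sat_clause_iff\<close>)
      show "sat_clause W \<rho> c Rp Cp"
        using seg(3)[of "Suc i", OF _ _ as] final i by (cases "Suc i = T") auto
    qed
    \<comment> \<open>The first letter of \<open>b @ [sp]\<close> takes the edge to
      \<open>?v1\<close>, the rest waits there; for empty \<open>b\<close> that letter is
      \<open>sp\<close> itself.\<close>
    have rbs: "reach ?step va (b @ [sp]) ?v1"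
    proof -
      have "\<forall>c\<in>set (b @ [sp]). sat_clause W \<rho> c Rp Cp" using rb sat by simp
      moreover obtain c cs where "b @ [sp] = c # cs" by (cases b) auto
      ultimately show ?thesis
        using to_v1 reach_stay[of cs ?step ?v1] at_v1 by auto
    qed
    have x: "reach ?step va ([sp] @ a) va" using to_v1[OF sat] ra by auto
    have y: "reach ?step va ((b @ [sp]) @ a) va" using rbs ra unfolding reach_append by blast
    have "suf\<^sup>\<omega> = ([sp] @ a) \<frown> ((b @ [sp]) @ a)\<^sup>\<omega>"
    \<comment> \<open>For horizon 0 of the return segment \<open>b\<close> is empty; the loop then
      already ends at \<open>va\<close> and unrolling it once replaces the rotation.\<close>
    proof (cases "b = []")
      case True
      then show ?thesis unfolding suf using iter_unroll[of "[sp] @ a"] by simp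
    next
      case False
      then show ?thesis unfolding suf using iter_rotate[of b "[sp] @ a"] by simp
    qed
    then show ?thesis using x y by blast
  qed
qed

theorem mainTheorem2:
  fixes W :: "'c wspace" and \<phi> :: ltl and A :: "'v nba" and I :: impl
    and \<alpha> :: real and M :: nat and pre suf :: "'c config list"
  assumes "workspace W"
    and "formula_over W \<phi>" and "valid \<phi>"
    and "nba_for A \<phi>"
    and "returned W I \<alpha> M A pre suf"
  shows "satisfies W (pre \<frown> suf\<^sup>\<omega>) \<phi>"
proof -
  let ?G = "prep W (collision I) A"
  obtain \<rho> va vp Cp Rp used where
    p: "prefix_synthesis W I \<alpha> M ?G \<rho> va pre vp Cp Rp used"
    and s: "suffix_synthesis W I \<alpha> M ?G \<rho> va (last pre) vp Cp Rp used suf"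
    using assms(5) unfolding returned_def Let_def by blast
  let ?step = "\<lambda>c u v. sat_label W \<rho> c (lab ?G u v)"
  have lab: "typed_labels W (lab ?G)" by (rule typed_labels_prep[OF assms(1,2,4)])
  note pr = prefix_reach[OF assms(1) lab p]
  obtain v0 where v0: "v0 \<in> inits ?G" "reach ?step v0 pre va" using pr(1) by blast
  obtain x y where xy: "suf\<^sup>\<omega> = x \<frown> y\<^sup>\<omega>" "y \<noteq> []" "reach ?step va x va" "reach ?step va y va"
    using suffix_reach[OF assms(1) lab s pr(2-4)] by blast
  have "reach ?step v0 (pre @ x) va" using v0(2) xy(3) unfolding reach_append by blast
  from lasso_run[OF this xy(4,2)] obtain run where "run 0 = v0"
    "\<And>t. ?step (((pre @ x) \<frown> y\<^sup>\<omega>) t) (run t) (run (Suc t))" "va \<in> limit run"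
    by blast
  moreover have "pre \<frown> suf\<^sup>\<omega> = (pre @ x) \<frown> y\<^sup>\<omega>" unfolding xy(1) by simp
  ultimately show ?thesis
    using satisfies_if_run[OF assms(1,2,4), of run] v0(1) pr(2) by metis
qed

end
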